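(* Let $Q=\{x\in\mathbb{R}^n\mid Ax\le b\}$ be a nonempty polyhedron, $\psi:\mathbb{R}^n\to(-\infty,\infty]$ proper and convex, $\varepsilon\ge0$, and $z\in\mathrm{vert}(Q)$. Let $T^i$ denote the facets of the polyhedral normal cone $N(z)$, with associated inward unit normals $s^i$. Then for any $v\in\partial\psi(z)$, $$\gamma\big(M(N(z),\partial(\varepsilon\psi)(z))\big)\ \le\ 2\varepsilon F(N(z),v)\exp\big(\varepsilon\sqrt{n-1}\,\|v\|\big).$$ Furthermore, if $\psi$ is differentiable at $z$ and $\nabla\psi(z)\in N(z)$, then $$\gamma\big(M(N(z),\varepsilon\nabla\psi(z))\big)\ \ge\ \varepsilon F(N(z),\nabla\psi(z))\exp\big(-\varepsilon\sqrt{n-1}\,\|\nabla\psi(z)\|-\tfrac12\varepsilon^2\|\nabla\psi(z)\|^2\big).$$ Alternatively, if $\psi$ is differentiable at $z$, $\nabla\psi(z)\notin N(z)$ is allowed, but the vertex $z$ is nondegenerate, then with $\tilde v:=S^{-1}(S\nabla\psi(z))_+$, $$\gamma\big(M(N(z),\varepsilon\nabla\psi(z))\big)\ \ge\ \varepsilon F(N(z),\nabla\psi(z))\exp\big(-\varepsilon\sqrt{n-1}\,\|\tilde v\|-\tfrac12\varepsilon^2\|\tilde v\|^2\big).$$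
   Context: $A\in\mathbb{R}^{m\times n}$ has rows $a_i$. $\mathrm{vert}(Q)$ is the set of vertices of $Q$; a vertex $z$ is nondegenerate if exactly $n$ constraints $a_i\cdot z\le b_i$ are active (hold with equality) at $z$. $N(x)=\{v\in\mathbb{R}^n\mid v\cdot(y-x)\le0\ \text{for all }y\in Q\}$ is the normal cone at $x$. For a vertex $z$, $N(z)$ is a full-dimensional polyhedral cone, $N(z)=\{y\mid y\cdot s^i\ge0,\ i=1,\dots,\ell\}$, where the $s^i$ are the inward-facing unit normals of its facets $T^i=\{y\in N(z)\mid s^i\cdot y=0\}$ (its $(n-1)$-dimensional faces); $S\in\mathbb{R}^{\ell\times n}$ is the matrix with rows $s^1,\dots,s^\ell$, which is square and invertible if $z$ is nondegenerate. $a_+=\max(0,a)$, componentwise for vectors. For a cone $T$ and a vector or set $w$, the margin is $M(T,w)=T\setminus[T+w]$ (Minkowski sum if $w$ is a set). $\gamma$ is the standard Gaussian measure on $\mathbb{R}^n$, and for a cone $K$, $\gamma_{\mathrm{rel}}(K)=\mathbb{P}(\mathrm{proj}_{\mathrm{span}(K)}\,g\in K)$ with $g\sim\mathcal N(0,I_n)$. For $w\in\mathbb{R}^n$, $$F(N(z),w)=\frac1{\sqrt{2\pi}}\sum_{i=1}^\ell\gamma_{\mathrm{rel}}(T^i)(s^i\cdot w)_+.$$ Convention: for $\varepsilon>0$, $\varepsilon\psi$ is the usual scalar multiple; for $\varepsilon=0$, $\varepsilon\psi$ denotes the indicator function $\delta_{\mathrm{dom}\,\psi}$. $\partial$ is the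 convex subdifferential. *)

theory Defs
  imports "HOL-Analysis.Analysis"
begin

section \<open>Extended-valued convex functions\<close>

definition effective_domain :: "('a \<Rightarrow> ereal) \<Rightarrow> 'a set" where
  "effective_domain f = {x. f x < \<infinity>}"

definition proper_fun :: "('a \<Rightarrow> ereal) \<Rightarrow> bool" where
  "proper_fun f \<longleftrightarrow> (\<forall>x. f x \<noteq> -\<infinity>) \<and> effective_domain f \<noteq> {}"

text \<open>Convexity of the epigraph: \<open>convex_on\<close> only covers real-valued functions.\<close>
definition convex_fun :: "('a::real_vector \<Rightarrow> ereal) \<Rightarrow> bool" where
  "convex_fun f \<longleftrightarrow> convex {(x, r::real). f x \<le> ereal r}"

text \<open>For a proper \<open>f\<close> this is empty at points outside the domain, as usual.\<close>
definition subdifferential :: "('a::real_inner \<Rightarrow> ereal) \<Rightarrow> 'a \<Rightarrow> 'a set" where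
  "subdifferential f x = {v. \<forall>y. f y \<ge> f x + ereal (v \<bullet> (y - x))}"

definition convex_indicator :: "'a set \<Rightarrow> 'a \<Rightarrow> ereal" where
  "convex_indicator S x = (if x \<in> S then 0 else \<infinity>)"

definition scale_fun :: "real \<Rightarrow> ('a \<Rightarrow> ereal) \<Rightarrow> 'a \<Rightarrow> ereal" where
  "scale_fun \<epsilon> f =
     (if \<epsilon> = 0 then convex_indicator (effective_domain f) else (\<lambda>x. ereal \<epsilon> * f x))"

text \<open>Differentiability at \<open>x\<close> includes finiteness near \<open>x\<close>; this clause is needed
  because \<open>real_of_ereal\<close> maps infinite values to \<open>0\<close>.\<close>
definition has_gradient :: "('a::real_inner \<Rightarrow> ereal) \<Rightarrow> 'a \<Rightarrow> 'a \<Rightarrow> bool" where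
  "has_gradient f g x \<longleftrightarrow>
     (\<forall>\<^sub>F y in nhds x. \<bar>f y\<bar> \<noteq> \<infinity>) \<and> GDERIV (\<lambda>y. real_of_ereal (f y)) x :> g"

section \<open>Polyhedra, normal cones, margins\<close>

text \<open>Vertices are the library's extreme points.\<close>
definition nondegenerate_vertex :: "real^'n^'m \<Rightarrow> real^'m \<Rightarrow> real^'n \<Rightarrow> bool" where
  "nondegenerate_vertex A b z \<longleftrightarrow>
     z extreme_point_of {x. A *v x \<le> b} \<and> card {i. row i A \<bullet> z = b $ i} = CARD('n)"

definition normal_cone :: "'a::real_inner set \<Rightarrow> 'a \<Rightarrow> 'a set" where
  "normal_cone Q x = {v. \<forall>y\<in>Q. v \<bullet> (y - x) \<le> 0}"

definition facets :: "'a::euclidean_space set \<Rightarrow> 'a set set" where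
  "facets K = {T. T facet_of K}"

text \<open>Unique when \<open>K\<close> is a full-dimensional polyhedral cone and \<open>T\<close> a facet of \<open>K\<close>.\<close>
definition inward_normal :: "'a::real_inner set \<Rightarrow> 'a set \<Rightarrow> 'a" where
  "inward_normal K T =
     (THE s. norm s = 1 \<and> (\<forall>y\<in>K. s \<bullet> y \<ge> 0) \<and> T = {y \<in> K. s \<bullet> y = 0})"

text \<open>\<open>+\<close> is the Minkowski sum; a vector \<open>w\<close> is passed as \<open>{w}\<close>.\<close>
definition margin :: "'a::ab_group_add set \<Rightarrow> 'a set \<Rightarrow> 'a set" where
  "margin T W = T - (T + W)"

definition pos_part :: "real^'n \<Rightarrow> real^'n" where
  "pos_part x = (\<chi> i. max 0 (x $ i))"

section \<open>Gaussian measure\<close>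

definition std_gaussian :: "'a::euclidean_space measure" where
  "std_gaussian =
     density lborel (\<lambda>x. ennreal (exp (- (norm x)\<^sup>2 / 2) / sqrt (2 * pi) ^ DIM('a)))"

text \<open>\<open>closest_point (span K)\<close> is the orthogonal projection onto \<open>span K\<close>.\<close>
definition gauss_rel :: "'a::euclidean_space set \<Rightarrow> real" where
  "gauss_rel K = measure std_gaussian {g. closest_point (span K) g \<in> K}"

definition margin_functional :: "'a::euclidean_space set \<Rightarrow> 'a \<Rightarrow> real" where
  "margin_functional K w =
     1 / sqrt (2 * pi) * (\<Sum>T\<in>facets K. gauss_rel T * max 0 (inward_normal K T \<bullet> w))"

section \<open>Facet normals at a nondegenerate vertex\<close>

text \<open>\<open>S\<close> has the inward unit facet normals of \<open>K\<close> as rows, in some order. The index type of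
  the rows equals that of the columns, so this applies only to cones with exactly \<open>CARD('n)\<close>
  facets; the lemma at the end shows that normal cones at nondegenerate vertices are such.\<close>
definition facet_normal_matrix :: "(real^'n) set \<Rightarrow> real^'n^'n \<Rightarrow> bool" where
  "facet_normal_matrix K S \<longleftrightarrow>
     (\<exists>T. bij_betw T UNIV (facets K) \<and> S = (\<chi> i. inward_normal K (T i)))"

lemma normal_cone_nondegenerate:
  fixes A :: "real^'n^'m"
  assumes nd: "nondegenerate_vertex A b z"
  obtains d a :: "'n \<Rightarrow> real^'n"
  where "normal_cone {x. A *v x \<le> b} z = {v. \<forall>j. 0 \<le> v \<bullet> d j}"
    "\<And>i j. a i \<bullet> d j = (if i = j then 1 else 0)"
proof -
  define Q where "Q = {x. A *v x \<le> b}"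
  define I where "I = {i. row i A \<bullet> z = b $ i}"
  have Qiff: "x \<in> Q \<longleftrightarrow> (\<forall>i. A $ i \<bullet> x \<le> b $ i)" for x
    by (simp add: Q_def less_eq_vec_def matrix_vector_mul_component)
  have Ieq: "I = {i. A $ i \<bullet> z = b $ i}"
    by (simp add: I_def row_def)
  have ext: "z extreme_point_of Q" and cI: "card I = CARD('n)"
    using nd by (auto simp: nondegenerate_vertex_def Q_def I_def)
  have zQ: "z \<in> Q" using ext by (simp add: extreme_point_of_def)
  obtain \<sigma> where \<sigma>: "bij_betw \<sigma> (UNIV::'n set) I"
    using cI by (metis finite finite_same_card_bij)
  have step: "\<exists>t>0. z + t *\<^sub>R d \<in> Q" if d: "\<And>i. i \<in> I \<Longrightarrow> A $ i \<bullet> d \<le> 0" for d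
  proof -
    have "\<forall>\<^sub>F t in at_right (0::real). A $ i \<bullet> (z + t *\<^sub>R d) \<le> b $ i" for i
    proof (cases "i \<in> I")
      case True
      have "\<forall>\<^sub>F t in at_right (0::real). t > 0" by (simp add: eventually_at_right_less)
      then show ?thesis
      proof eventually_elim
        case (elim t)
        then have "t * (A $ i \<bullet> d) \<le> 0" using d[OF True] by (simp add: mult_nonneg_nonpos)
        then show ?case using True by (simp add: Ieq inner_add_right)
      qed
    next
      case False
      then have lt: "A $ i \<bullet> z < b $ i" using zQ Qiff Ieq by (simp add: order_less_le)
      have "((\<lambda>t. A $ i \<bullet> (z + t *\<^sub>R d)) \<longlongrightarrow> A $ i \<bullet> (z + 0 *\<^sub>R d)) (at_right (0::real))"
        by (intro tendsto_intros)
      then have "\<forall>\<^sub>F t in at_right (0::real). A $ i \<bullet> (z + t *\<^sub>R d) < b $ i"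
        using lt by (auto dest: order_tendstoD(2))
      then show ?thesis by eventually_elim simp
    qed
    then have "\<forall>\<^sub>F t in at_right (0::real). \<forall>i. A $ i \<bullet> (z + t *\<^sub>R d) \<le> b $ i"
      by (simp add: eventually_all_finite)
    moreover have "\<forall>\<^sub>F t in at_right (0::real). t > 0" by (simp add: eventually_at_right_less)
    ultimately have "\<forall>\<^sub>F t in at_right (0::real). t > 0 \<and> z + t *\<^sub>R d \<in> Q"
      by eventually_elim (simp add: Qiff)
    then show ?thesis
      using eventually_happens trivial_limit_at_right_real by blast
  qed
  define a where "a = (\<lambda>k. A $ \<sigma> k)"
  have aI: "i \<in> I \<Longrightarrow> \<exists>k. A $ i = a k" for i
    using \<sigma> unfolding a_def bij_betw_def by blast
  have \<sigma>I: "\<sigma> k \<in> I" for k using \<sigma> unfolding bij_betw_def by blast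
  define B :: "real^'n^'n" where "B = (\<chi> k. a k)"
  have ker: "x = 0" if "B *v x = 0" for x
  proof (rule ccontr)
    assume "x \<noteq> 0"
    have "a k \<bullet> x = 0" for k
      using that by (simp add: vec_eq_iff matrix_vector_mul_component B_def)
    then have z0: "A $ i \<bullet> x = 0" if "i \<in> I" for i using aI[OF that] by auto
    obtain s where s: "s > 0" "z + s *\<^sub>R x \<in> Q" using step[of x] z0 by auto
    obtain t where t: "t > 0" "z + t *\<^sub>R (-x) \<in> Q" using step[of "-x"] z0 by auto
    have "z \<in> open_segment (z + s *\<^sub>R x) (z + t *\<^sub>R (-x))"
      unfolding in_segment
    proof (intro conjI exI[of _ "s / (s + t)"])
      have "s *\<^sub>R x \<noteq> (-t) *\<^sub>R x"
        using s t \<open>x \<noteq> 0\<close> unfolding scaleR_cancel_right by auto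
      then show "z + s *\<^sub>R x \<noteq> z + t *\<^sub>R (-x)" by simp
      have "z = z + ((1 - s / (s + t)) * s - s / (s + t) * t) *\<^sub>R x"
        using s t by (simp add: field_simps)
      then show "z = (1 - s / (s + t)) *\<^sub>R (z + s *\<^sub>R x) + (s / (s + t)) *\<^sub>R (z + t *\<^sub>R (-x))"
        by (simp add: algebra_simps)
    qed (use s t in auto)
    then show False using ext s t unfolding extreme_point_of_def by blast
  qed
  then have "invertible B"
    by (metis invertible_left_inverse matrix_left_invertible_ker)
  then obtain C where BC: "B ** C = mat 1" and CB: "C ** B = mat 1"
    by (auto simp: invertible_def)
  define d where "d = (\<lambda>j. column j C)"
  have ad: "a i \<bullet> d j = (if i = j then 1 else 0)" for i j
  proof -
    have "a i \<bullet> d j = (B ** C) $ i $ j"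
      by (simp add: matrix_matrix_mult_def inner_vec_def B_def d_def column_def)
    then show ?thesis by (simp add: BC mat_def)
  qed
  have expand: "v = (\<Sum>j\<in>UNIV. (v \<bullet> d j) *\<^sub>R a j)" for v
  proof -
    have coord: "(v v* C) $ j = v \<bullet> d j" for j
      by (simp add: vector_matrix_mult_def inner_vec_def d_def column_def mult.commute)
    have rows: "w v* B = (\<Sum>j\<in>UNIV. (w $ j) *\<^sub>R a j)" for w
      by (simp add: vec_eq_iff vector_matrix_mult_def B_def mult.commute)
    have "v = v v* (C ** B)" by (simp add: CB)
    also have "\<dots> = (v v* C) v* B" by (simp add: vector_matrix_mul_assoc)
    also have "\<dots> = (\<Sum>j\<in>UNIV. ((v v* C) $ j) *\<^sub>R a j)"
      by (rule rows)
    finally show ?thesis by (simp only: coord)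
  qed
  have "normal_cone Q z = {v. \<forall>j. 0 \<le> v \<bullet> d j}"
  proof (intro equalityI subsetI CollectI allI)
    fix v j assume v: "v \<in> normal_cone Q z"
    have "A $ i \<bullet> (- d j) \<le> 0" if "i \<in> I" for i using aI[OF that] ad by auto
    then obtain t where t: "t > 0" "z + t *\<^sub>R (- d j) \<in> Q" using step by blast
    then have "v \<bullet> (z + t *\<^sub>R (- d j) - z) \<le> 0" using v unfolding normal_cone_def by blast
    then have "0 \<le> t * (v \<bullet> d j)" by simp
    then show "0 \<le> v \<bullet> d j" using t by (simp add: zero_le_mult_iff)
  next
    fix v assume v: "v \<in> {v. \<forall>j. 0 \<le> v \<bullet> d j}"
    have "v \<bullet> (y - z) \<le> 0" if "y \<in> Q" for y
    proof -
      have "a j \<bullet> (y - z) \<le> 0" for j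
        using that \<sigma>I[of j] by (simp add: Qiff Ieq a_def inner_diff_right)
      then have "(\<Sum>j\<in>UNIV. (v \<bullet> d j) * (a j \<bullet> (y - z))) \<le> 0"
        using v by (intro sum_nonpos mult_nonneg_nonpos) auto
      also have "(\<Sum>j\<in>UNIV. (v \<bullet> d j) * (a j \<bullet> (y - z))) =
          (\<Sum>j\<in>UNIV. (v \<bullet> d j) *\<^sub>R a j) \<bullet> (y - z)"
        by (simp add: inner_sum_left)
      also have "\<dots> = v \<bullet> (y - z)" by (simp only: expand[of v, symmetric])
      finally show ?thesis .
    qed
    then show "v \<in> normal_cone Q z" by (simp add: normal_cone_def)
  qed
  then show ?thesis using that[of d a] ad unfolding Q_def by blast
qed

lemma nondegenerate_vertex_facet_normal_matrix:
  fixes A :: "real^'n^'m"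
  assumes "nondegenerate_vertex A b z"
  shows "\<exists>S. facet_normal_matrix (normal_cone {x. A *v x \<le> b} z) S"
proof -
  obtain d a :: "'n \<Rightarrow> real^'n"
    where N: "normal_cone {x. A *v x \<le> b} z = {v. \<forall>j. 0 \<le> v \<bullet> d j}" (is "?N = _")
      and ad: "\<And>i j. a i \<bullet> d j = (if i = j then 1 else 0)"
    by (rule normal_cone_nondegenerate[OF assms]) (rule that)
  define h where "h = (\<lambda>j. {v. (- d j) \<bullet> v \<le> 0})"
  have hin: "v \<in> h j \<longleftrightarrow> 0 \<le> v \<bullet> d j" for v j by (simp add: h_def inner_commute)
  define p where "p = (\<lambda>j. (\<Sum>i\<in>UNIV. a i) - 2 *\<^sub>R a j)"
  have pd: "p j \<bullet> d k = (if k = j then -1 else 1)" for j k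
    by (auto simp: p_def inner_diff_left inner_sum_left ad)
  have pin: "p j \<in> h k \<longleftrightarrow> k \<noteq> j" for j k by (simp add: hin pd)
  have injh: "inj h" by (rule injI) (metis pin)
  have d0: "d j \<noteq> 0" for j using ad[of j j] by auto
  have N_h: "?N = \<Inter> (range h)" unfolding N by (auto simp: hin)
  have "(\<Sum>i\<in>UNIV. a i) \<in> interior ?N"
  proof -
    have "open {v. \<forall>j\<in>UNIV. 0 < v \<bullet> d j}"
    proof -
      have "open (\<Inter>j\<in>UNIV. {v. 0 < v \<bullet> d j})"
        by (intro open_INT ballI open_Collect_less continuous_intros) auto
      moreover have "(\<Inter>j\<in>UNIV. {v. 0 < v \<bullet> d j}) = {v. \<forall>j\<in>UNIV. 0 < v \<bullet> d j}" by auto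
      ultimately show ?thesis by simp
    qed
    moreover have "{v. \<forall>j\<in>UNIV. 0 < v \<bullet> d j} \<subseteq> ?N" unfolding N by (auto intro: less_imp_le)
    moreover have "(\<Sum>i\<in>UNIV. a i) \<in> {v. \<forall>j\<in>UNIV. 0 < v \<bullet> d j}"
      by (simp add: inner_sum_left ad)
    ultimately show ?thesis by (meson interiorI)
  qed
  then have aff: "affine hull ?N = UNIV" by (intro affine_hull_nonempty_interior) auto
  have "C facet_of ?N \<longleftrightarrow> (\<exists>H. H \<in> range h \<and> C = ?N \<inter> {x. (- d (inv h H)) \<bullet> x = 0})" for C
  proof (rule facet_of_polyhedron_explicit)
    show "?N = affine hull ?N \<inter> \<Inter> (range h)" using N_h aff by simp
    show "- d (inv h H) \<noteq> 0 \<and> H = {x. - d (inv h H) \<bullet> x \<le> 0}" if "H \<in> range h" for H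
    proof -
      obtain j where "H = h j" using \<open>H \<in> range h\<close> by auto
      moreover from this have "inv h H = j" using injh by (simp add: inv_f_f)
      ultimately show ?thesis using d0[of j] by (simp add: h_def)
    qed
    show "?N \<subset> affine hull ?N \<inter> \<Inter> F'" if F': "F' \<subset> range h" for F'
    proof -
      obtain j where "h j \<notin> F'" using F' by auto
      then have "p j \<in> \<Inter> F'" using F' pin by auto
      moreover have "p j \<notin> ?N" using pin N_h by blast
      moreover have "?N \<subseteq> \<Inter> F'" using F' N_h by blast
      ultimately show ?thesis unfolding aff by blast
    qed
  qed simp
  then have fac: "facets ?N = range (\<lambda>j. ?N \<inter> {x. d j \<bullet> x = 0})"
    using injh by (auto simp: facets_def)
  have "inj (\<lambda>j. ?N \<inter> {x. d j \<bullet> x = 0})"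
  proof (rule injI, rule ccontr)
    fix i j assume eq: "?N \<inter> {x. d i \<bullet> x = 0} = ?N \<inter> {x. d j \<bullet> x = 0}" and "i \<noteq> j"
    then have "a i \<in> ?N \<inter> {x. d j \<bullet> x = 0}" unfolding N by (simp add: inner_commute[of "d j"] ad)
    then have "a i \<bullet> d i = 0" using eq by (auto simp: inner_commute)
    then show False by (simp add: ad)
  qed
  then show ?thesis unfolding facet_normal_matrix_def using fac
    by (auto simp: bij_betw_def)
qed

end

theory Submission
  imports Defs "HOL-Probability.Distributions"
begin

text \<open>Put \<open>w = \<epsilon> v\<close>. A point \<open>x\<close> of \<open>N\<close> with \<open>x - w \<notin> N\<close> leaves \<open>N\<close> along the segment to \<open>x - w\<close>
  through a facet \<open>T\<close> whose inward normal \<open>s\<close> satisfies \<open>s \<bullet> w > 0\<close>. So the margin is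
  covered by the slabs \<open>T + [0,1) w\<close>; for \<open>w \<in> N\<close> it is their union, and they overlap in null sets
  only. The Gaussian measure of a slab is an integral over \<open>t \<in> [0,1)\<close> of the Gaussian density on
  \<open>T + t w\<close>. With \<open>k = n - 1\<close>, the cross term \<open>t (y \<bullet> w)\<close> of its exponent is absorbed by AM-GM into
  multiples of \<open>|y|\<^sup>2\<close> and of \<open>sqrt k |w|\<close>, and since \<open>T\<close> is a cone, the remaining integral of
  \<open>exp (- \<lambda> |y|\<^sup>2 / 2)\<close> over \<open>T\<close> is \<open>\<lambda> powr (- k / 2)\<close> times the one for \<open>\<lambda> = 1\<close>. The optimal
  weights give the factors \<open>exp (\<plusminus> sqrt k |w|)\<close>. At a nondegenerate vertex, replacing the facet
  coordinates of the gradient by their positive parts does not change the margin.\<close>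

section \<open>Integration along a hyperplane\<close>

lemma nn_integral_lborel_translate:
  fixes f :: "'a::euclidean_space \<Rightarrow> ennreal"
  assumes [measurable]: "f \<in> borel_measurable borel"
  shows "(\<integral>\<^sup>+x. f (x + a) \<partial>lborel) = (\<integral>\<^sup>+x. f x \<partial>lborel)"
proof -
  have "(\<integral>\<^sup>+x. f x \<partial>lborel) = (\<integral>\<^sup>+x. f x \<partial>distr lborel borel ((+) a))"
    by (simp add: lborel_distr_plus)
  also have "\<dots> = (\<integral>\<^sup>+x. f (x + a) \<partial>lborel)"
    by (subst nn_integral_distr) (simp_all add: add.commute)
  finally show ?thesis ..
qed

lemma nn_integral_lborel_scale:
  fixes f :: "'a::euclidean_space \<Rightarrow> ennreal"
  assumes [measurable]: "f \<in> borel_measurable borel" and "c \<noteq> 0"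
  shows "(\<integral>\<^sup>+x. f x \<partial>lborel) = ennreal (\<bar>c\<bar> ^ DIM('a)) * (\<integral>\<^sup>+x. f (c *\<^sub>R x) \<partial>lborel)"
  by (subst lborel_affine[OF \<open>c \<noteq> 0\<close>, of 0])
     (simp add: nn_integral_density nn_integral_distr nn_integral_cmult)

text \<open>For unit \<open>s\<close>, the orthogonal projection onto the hyperplane
  \<open>s \<bullet> y = 0\<close>.\<close>

definition orth_part :: "'a::real_inner \<Rightarrow> 'a \<Rightarrow> 'a" where
  "orth_part s x = x - (s \<bullet> x) *\<^sub>R s"

lemma orth_part_measurable [measurable]:
  "orth_part s \<in> borel_measurable (borel :: 'a::euclidean_space measure)"
  unfolding orth_part_def by measurable

lemma inner_orth_part: "norm s = 1 \<Longrightarrow> s \<bullet> orth_part s x = 0"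
  by (simp add: orth_part_def inner_diff_right dot_square_norm)

lemma norm_orth_part: "norm s = 1 \<Longrightarrow> (norm x)\<^sup>2 = (norm (orth_part s x))\<^sup>2 + (s \<bullet> x)\<^sup>2"
  unfolding orth_part_def power2_norm_eq_inner norm_eq_1
  by (simp add: inner_diff_left inner_diff_right inner_commute power2_eq_square)

text \<open>Tonelli together with translation invariance replaces a choice of coordinates in which
  \<open>s\<close> is a basis vector: the weight \<open>h\<close> stands for the missing Lebesgue measure on the
  hyperplane orthogonal to \<open>s\<close>.\<close>
lemma nn_integral_disintegrate:
  fixes F :: "'a::euclidean_space \<Rightarrow> ennreal" and h :: "real \<Rightarrow> ennreal"
  assumes [measurable]: "F \<in> borel_measurable borel" "h \<in> borel_measurable borel"
    and h: "(\<integral>\<^sup>+r. h r \<partial>lborel) = 1" and s: "norm s = 1" and w: "s \<bullet> w = 1"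
  shows "(\<integral>\<^sup>+x. F x \<partial>lborel) =
    (\<integral>\<^sup>+r. (\<integral>\<^sup>+x. h (s \<bullet> x) * F (orth_part s x + r *\<^sub>R w) \<partial>lborel) \<partial>lborel)"
proof -
  have ss: "s \<bullet> s = 1" using s by (simp add: norm_eq_1)
  have h': "(\<integral>\<^sup>+r. h (a - r) \<partial>lborel) = 1" for a
    using nn_integral_real_affine[of h "-1" a] h by simp
  \<comment> \<open>Every reflected shift of \<open>h\<close> has integral 1, so it can be inserted
    as a factor.\<close>
  have "(\<integral>\<^sup>+x. F x \<partial>lborel) = (\<integral>\<^sup>+x. F x * (\<integral>\<^sup>+r. h (s \<bullet> x - r) \<partial>lborel) \<partial>lborel)"
    by (simp add: h')
  also have "\<dots> = (\<integral>\<^sup>+x. (\<integral>\<^sup>+r. F x * h (s \<bullet> x - r) \<partial>lborel) \<partial>lborel)"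
    by (intro nn_integral_cong nn_integral_cmult[symmetric]) simp
  also have "\<dots> = (\<integral>\<^sup>+r. (\<integral>\<^sup>+x. F x * h (s \<bullet> x - r) \<partial>lborel) \<partial>lborel)"
    by (rule lborel_pair.Fubini') measurable
  \<comment> \<open>Shift \<open>x\<close> by \<open>r *\<^sub>R s\<close>, which raises
    \<open>s \<bullet> x\<close> by exactly \<open>r\<close>.\<close>
  also have "\<dots> = (\<integral>\<^sup>+r. (\<integral>\<^sup>+x. F (x + r *\<^sub>R s) * h (s \<bullet> x) \<partial>lborel) \<partial>lborel)"
  proof (rule nn_integral_cong)
    fix r
    show "(\<integral>\<^sup>+x. F x * h (s \<bullet> x - r) \<partial>lborel) =
      (\<integral>\<^sup>+x. F (x + r *\<^sub>R s) * h (s \<bullet> x) \<partial>lborel)"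
      by (subst nn_integral_lborel_translate[of _ "r *\<^sub>R s", symmetric])
        (simp_all add: inner_add_right ss)
  qed
  also have "\<dots> = (\<integral>\<^sup>+x. (\<integral>\<^sup>+r. F (x + r *\<^sub>R s) * h (s \<bullet> x) \<partial>lborel) \<partial>lborel)"
    by (rule lborel_pair.Fubini') measurable
  \<comment> \<open>For fixed \<open>x\<close>, shift \<open>r\<close> by
    \<open>- (s \<bullet> x)\<close>: only the orthogonal part of \<open>x\<close> remains in the
    argument of \<open>F\<close>.\<close>
  also have "\<dots> = (\<integral>\<^sup>+x. (\<integral>\<^sup>+r. F (orth_part s x + r *\<^sub>R s) * h (s \<bullet> x) \<partial>lborel) \<partial>lborel)"
  proof (rule nn_integral_cong)
    fix x
    show "(\<integral>\<^sup>+r. F (x + r *\<^sub>R s) * h (s \<bullet> x) \<partial>lborel) =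
      (\<integral>\<^sup>+r. F (orth_part s x + r *\<^sub>R s) * h (s \<bullet> x) \<partial>lborel)"
      by (subst nn_integral_lborel_translate[of _ "- (s \<bullet> x)", symmetric])
        (simp_all add: orth_part_def algebra_simps)
  qed
  also have "\<dots> = (\<integral>\<^sup>+r. (\<integral>\<^sup>+x. F (orth_part s x + r *\<^sub>R s) * h (s \<bullet> x) \<partial>lborel) \<partial>lborel)"
    by (rule lborel_pair.Fubini') measurable
  \<comment> \<open>A shear turns \<open>s\<close> into \<open>w\<close>: the shift of
    \<open>x\<close> by \<open>r *\<^sub>R (w - s)\<close> is orthogonal to \<open>s\<close> and
    leaves the weight unchanged.\<close>
  also have "\<dots> = (\<integral>\<^sup>+r. (\<integral>\<^sup>+x. h (s \<bullet> x) * F (orth_part s x + r *\<^sub>R w) \<partial>lborel) \<partial>lborel)"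
  proof (rule nn_integral_cong)
    fix r
    show "(\<integral>\<^sup>+x. F (orth_part s x + r *\<^sub>R s) * h (s \<bullet> x) \<partial>lborel) =
      (\<integral>\<^sup>+x. h (s \<bullet> x) * F (orth_part s x + r *\<^sub>R w) \<partial>lborel)"
      by (subst nn_integral_lborel_translate[of _ "r *\<^sub>R (w - s)", symmetric], simp)
        (simp add: orth_part_def inner_add_right inner_diff_right ss w algebra_simps)
  qed
  finally show ?thesis .
qed

section \<open>Gaussian measure of slabs\<close>

lemma std_normal_nn_integral: "(\<integral>\<^sup>+x. ennreal (std_normal_density x) \<partial>lborel) = 1"
  by (subst nn_integral_eq_integral) auto

lemma sets_std_gaussian [simp, measurable_cong]: "sets std_gaussian = sets borel"
  and space_std_gaussian [simp]: "space std_gaussian = UNIV"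
  by (simp_all add: std_gaussian_def)

lemma emeasure_std_gaussian:
  fixes S :: "'a::euclidean_space set"
  assumes "S \<in> sets borel"
  shows "emeasure std_gaussian S =
    (\<integral>\<^sup>+x. ennreal (exp (- (norm x)\<^sup>2 / 2) / sqrt (2 * pi) ^ DIM('a)) * indicator S x \<partial>lborel)"
  unfolding std_gaussian_def using assms by (subst emeasure_density) simp_all

lemma prob_space_std_gaussian: "prob_space (std_gaussian :: 'a::euclidean_space measure)"
proof
  \<comment> \<open>The density factors over the coordinates, so its integral is a product of
    one-dimensional normal integrals.\<close>
  have eq: "ennreal (exp (- (norm x)\<^sup>2 / 2) / sqrt (2 * pi) ^ DIM('a)) =
      (\<Prod>b\<in>Basis. ennreal (std_normal_density (x \<bullet> b)))" for x :: 'a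
  proof -
    have "(\<Prod>b\<in>Basis. std_normal_density (x \<bullet> b)) =
        (\<Prod>b\<in>Basis. exp (- (x \<bullet> b)\<^sup>2 / 2)) / sqrt (2 * pi) ^ DIM('a)"
      by (simp add: std_normal_density_def prod_dividef)
    also have "(\<Prod>b\<in>Basis. exp (- (x \<bullet> b)\<^sup>2 / 2)) = exp (- (norm x)\<^sup>2 / 2)"
      by (simp add: exp_sum[symmetric] norm_eq_sqrt_inner euclidean_inner[of x x]
          sum_nonneg sum_divide_distrib[symmetric] sum_negf power2_eq_square)
    finally show ?thesis by (simp add: prod_ennreal)
  qed
  have "emeasure (std_gaussian :: 'a measure) UNIV =
      (\<integral>\<^sup>+(x::'a). (\<Prod>b\<in>Basis. ennreal (std_normal_density (x \<bullet> b))) \<partial>lborel)"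
    by (subst emeasure_std_gaussian) (simp_all only: eq, simp_all)
  also have "\<dots> = 1"
    by (subst nn_integral_lborel_prod) (simp_all add: std_normal_nn_integral)
  finally show "emeasure (std_gaussian :: 'a measure) (space std_gaussian) = 1" by simp
qed

interpretation std_gaussian: prob_space "std_gaussian :: 'a::euclidean_space measure"
  by (rule prob_space_std_gaussian)

text \<open>For unit \<open>s\<close>, the integral of \<open>exp (- l |y|^2 / 2)\<close> over the
  part of \<open>T\<close> in the hyperplane orthogonal to \<open>s\<close>. The normal density in
  \<open>s \<bullet> x\<close> is the weight of \<open>nn_integral_disintegrate\<close>; it
  integrates out to 1.\<close>

definition cone_integral :: "'a::euclidean_space \<Rightarrow> 'a set \<Rightarrow> real \<Rightarrow> ennreal" where
  "cone_integral s T l = (\<integral>\<^sup>+x. ennreal (std_normal_density (s \<bullet> x)) *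
     (indicator T (orth_part s x) * ennreal (exp (- (l * (norm (orth_part s x))\<^sup>2 / 2)))) \<partial>lborel)"

lemma orth_part_add: "norm s = 1 \<Longrightarrow> orth_part s (orth_part s x + r *\<^sub>R s) = orth_part s x"
  by (simp add: orth_part_def inner_add_right inner_diff_right dot_square_norm algebra_simps)

lemma orth_part_scaleR: "orth_part s (m *\<^sub>R x) = m *\<^sub>R orth_part s x"
  by (simp add: orth_part_def algebra_simps)

text \<open>Scaling the whole space by \<open>m\<close> gives the power \<open>DIM('a)\<close>, one
  factor too many for a hyperplane. The surplus \<open>m\<close> is absorbed by the normal
  coordinate, where \<open>m * h (m * r)\<close> again has integral 1.\<close>

lemma cone_integral_scale:
  fixes s :: "'a::euclidean_space"
  assumes [measurable]: "T \<in> sets borel" and s: "norm s = 1" and m: "m > 0"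
    and cone: "\<And>y c. c > 0 \<Longrightarrow> c *\<^sub>R y \<in> T \<longleftrightarrow> y \<in> T"
  shows "cone_integral s T 1 = ennreal (m ^ (DIM('a) - 1)) * cone_integral s T (m\<^sup>2)"
proof -
  define h where "h r = ennreal (std_normal_density r)" for r
  define f where "f l x = (indicator T (orth_part s x) *
    ennreal (exp (- (l * (norm (orth_part s x))\<^sup>2 / 2))))" for l and x :: 'a
  have [measurable]: "h \<in> borel_measurable borel" "f l \<in> borel_measurable borel" for l
    unfolding h_def f_def by measurable
  have K: "cone_integral s T l = (\<integral>\<^sup>+x. h (s \<bullet> x) * f l x \<partial>lborel)" for l
    by (simp add: cone_integral_def h_def f_def)
  have fm: "f 1 (m *\<^sub>R x) = f (m\<^sup>2) x" for x
    using cone[OF m] m by (simp add: f_def orth_part_scaleR power_mult_distrib indicator_def)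
  have h1: "(\<integral>\<^sup>+r. h r \<partial>lborel) = 1" by (simp add: h_def std_normal_nn_integral)
  have h2: "(\<integral>\<^sup>+r. ennreal m * h (m * r) \<partial>lborel) = 1"
    using nn_integral_real_affine[of h m 0] h1 m by (simp add: nn_integral_cmult)
  have n: "ennreal (m ^ DIM('a)) = ennreal (m ^ (DIM('a) - 1)) * ennreal m"
    using m power_minus_mult[OF DIM_positive[where 'a='a], of m]
    by (simp add: ennreal_mult[symmetric])
  have "cone_integral s T 1 = ennreal (m ^ DIM('a)) * (\<integral>\<^sup>+x. h (s \<bullet> (m *\<^sub>R x)) * f 1 (m *\<^sub>R x) \<partial>lborel)"
    unfolding K using m by (subst nn_integral_lborel_scale[of _ m]) simp_all
  also have "\<dots> = ennreal (m ^ (DIM('a) - 1)) * (\<integral>\<^sup>+x. (ennreal m * h (m * (s \<bullet> x))) * f (m\<^sup>2) x \<partial>lborel)"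
    by (simp add: fm n nn_integral_cmult mult.assoc)
  \<comment> \<open>Disintegration along \<open>s\<close> itself separates the normal coordinate
    \<open>r\<close> from \<open>f\<close>, which depends on the orthogonal part only.\<close>
  also have "(\<integral>\<^sup>+x. (ennreal m * h (m * (s \<bullet> x))) * f (m\<^sup>2) x \<partial>lborel) =
    (\<integral>\<^sup>+r. (\<integral>\<^sup>+x. (ennreal m * h (m * r)) * (h (s \<bullet> x) * f (m\<^sup>2) x) \<partial>lborel) \<partial>lborel)"
  proof (subst nn_integral_disintegrate[OF _ _ h1 s, of _ s])
    show "s \<bullet> s = 1" using s by (simp add: norm_eq_1)
    then have "s \<bullet> (orth_part s x + r *\<^sub>R s) = r" for x r
      by (simp add: inner_add_right inner_orth_part s)
    moreover have "f (m\<^sup>2) (orth_part s x + r *\<^sub>R s) = f (m\<^sup>2) x" for x r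
      by (simp add: f_def orth_part_add s)
    ultimately show "(\<integral>\<^sup>+r. (\<integral>\<^sup>+x. h (s \<bullet> x) * (ennreal m * h (m * (s \<bullet> (orth_part s x + r *\<^sub>R s))) *
        f (m\<^sup>2) (orth_part s x + r *\<^sub>R s)) \<partial>lborel) \<partial>lborel) =
      (\<integral>\<^sup>+r. (\<integral>\<^sup>+x. (ennreal m * h (m * r)) * (h (s \<bullet> x) * f (m\<^sup>2) x) \<partial>lborel) \<partial>lborel)"
      by (simp only: mult.assoc mult.left_commute)
  qed measurable
  also have "\<dots> = (\<integral>\<^sup>+r. (ennreal m * h (m * r)) * cone_integral s T (m\<^sup>2) \<partial>lborel)"
    unfolding K by (intro nn_integral_cong nn_integral_cmult) simp
  also have "\<dots> = cone_integral s T (m\<^sup>2)"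
    by (subst nn_integral_multc) (simp_all only: h2, simp_all)
  finally show ?thesis .
qed

text \<open>By Pythagoras the normal density of \<open>s \<bullet> x\<close> and the exponential of
  the orthogonal part multiply to the Gaussian density, up to powers of
  \<open>sqrt (2 * pi)\<close>.\<close>

lemma cone_integral_1:
  fixes s :: "'a::euclidean_space"
  assumes [measurable]: "T \<in> sets borel" and s: "norm s = 1"
  shows "cone_integral s T 1 =
    ennreal (sqrt (2 * pi) ^ (DIM('a) - 1) * measure std_gaussian {x. orth_part s x \<in> T})"
proof -
  have S: "{x. orth_part s x \<in> T} \<in> sets borel" by measurable
  have n: "sqrt (2 * pi) ^ DIM('a) = sqrt (2 * pi) ^ (DIM('a) - 1) * sqrt (2 * pi)"
    using power_minus_mult[OF DIM_positive[where 'a='a], of "sqrt (2 * pi)"] by simp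
  have eq: "std_normal_density (s \<bullet> x) * exp (- (1 * (norm (orth_part s x))\<^sup>2 / 2)) =
    sqrt (2 * pi) ^ (DIM('a) - 1) * (exp (- (norm x)\<^sup>2 / 2) / sqrt (2 * pi) ^ DIM('a))" for x
    unfolding n norm_orth_part[OF s, of x]
    by (simp add: std_normal_density_def exp_add[symmetric] field_simps)
  have "cone_integral s T 1 = (\<integral>\<^sup>+x. ennreal (sqrt (2 * pi) ^ (DIM('a) - 1)) *
      (ennreal (exp (- (norm x)\<^sup>2 / 2) / sqrt (2 * pi) ^ DIM('a)) *
      indicator {x. orth_part s x \<in> T} x) \<partial>lborel)"
    unfolding cone_integral_def
    using eq by (intro nn_integral_cong) (auto simp: indicator_def ennreal_mult[symmetric])
  also have "\<dots> = ennreal (sqrt (2 * pi) ^ (DIM('a) - 1)) * emeasure std_gaussian {x. orth_part s x \<in> T}"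
    by (subst nn_integral_cmult) (simp_all add: emeasure_std_gaussian)
  finally show ?thesis
    by (simp add: std_gaussian.emeasure_eq_measure ennreal_mult)
qed

text \<open>For \<open>T\<close> orthogonal to \<open>s\<close> and \<open>s \<bullet> w > 0\<close>
  this is \<open>T + [0,1) w\<close>: the height \<open>s \<bullet> x\<close> determines the shift
  \<open>t = (s \<bullet> x) / (s \<bullet> w)\<close>. In this form measurability is
  immediate.\<close>

definition slab :: "'a::euclidean_space \<Rightarrow> 'a \<Rightarrow> 'a set \<Rightarrow> 'a set" where
  "slab s w T = {x. 0 \<le> s \<bullet> x \<and> s \<bullet> x < s \<bullet> w \<and> x - (s \<bullet> x / (s \<bullet> w)) *\<^sub>R w \<in> T}"

lemma slab_measurable:
  assumes [measurable]: "T \<in> sets borel"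
  shows "slab s w T \<in> sets borel"
  unfolding slab_def by measurable

text \<open>Disintegration along \<open>w / (s \<bullet> w)\<close>, whose component along
  \<open>s\<close> is 1: \<open>r\<close> is the height above the hyperplane and
  \<open>r / (s \<bullet> w)\<close> the shift in \<open>[0,1)\<close>.\<close>

lemma emeasure_slab:
  fixes s :: "'a::euclidean_space"
  assumes [measurable]: "T \<in> sets borel" and s: "norm s = 1" and c: "s \<bullet> w > 0"
  shows "emeasure std_gaussian (slab s w T) =
    (\<integral>\<^sup>+r. (\<integral>\<^sup>+x. indicator {0..<s \<bullet> w} r * (ennreal (std_normal_density (s \<bullet> x)) *
      (indicator T (orth_part s x) *
        ennreal (exp (- (norm (orth_part s x + (r / (s \<bullet> w)) *\<^sub>R w))\<^sup>2 / 2) / sqrt (2 * pi) ^ DIM('a))))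
      \<partial>lborel) \<partial>lborel)"
proof -
  have [measurable]: "slab s w T \<in> sets borel" by (simp add: slab_measurable)
  have in_slab: "orth_part s x + (r / (s \<bullet> w)) *\<^sub>R w \<in> slab s w T \<longleftrightarrow>
      r \<in> {0..<s \<bullet> w} \<and> orth_part s x \<in> T" for x r
    using c by (auto simp: slab_def inner_add_right inner_orth_part[OF s])
  have ind: "indicator (slab s w T) (orth_part s x + (r / (s \<bullet> w)) *\<^sub>R w) =
      (indicator {0..<s \<bullet> w} r * indicator T (orth_part s x) :: ennreal)" for x r
    by (simp add: in_slab indicator_def)
  have rw: "r *\<^sub>R (w /\<^sub>R (s \<bullet> w)) = (r / (s \<bullet> w)) *\<^sub>R w" for r
    by (simp add: divide_inverse)
  have "emeasure std_gaussian (slab s w T) = (\<integral>\<^sup>+x. ennreal (exp (- (norm x)\<^sup>2 / 2) / sqrt (2 * pi) ^ DIM('a))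
      * indicator (slab s w T) x \<partial>lborel)"
    by (simp add: emeasure_std_gaussian)
  also have "\<dots> = (\<integral>\<^sup>+r. (\<integral>\<^sup>+x. ennreal (std_normal_density (s \<bullet> x)) *
      (ennreal (exp (- (norm (orth_part s x + r *\<^sub>R (w /\<^sub>R (s \<bullet> w))))\<^sup>2 / 2) / sqrt (2 * pi) ^ DIM('a))
      * indicator (slab s w T) (orth_part s x + r *\<^sub>R (w /\<^sub>R (s \<bullet> w)))) \<partial>lborel) \<partial>lborel)"
    by (rule nn_integral_disintegrate) (use s c in \<open>simp_all add: std_normal_nn_integral\<close>)
  also have "\<dots> = (\<integral>\<^sup>+r. (\<integral>\<^sup>+x. indicator {0..<s \<bullet> w} r * (ennreal (std_normal_density (s \<bullet> x)) *
      (indicator T (orth_part s x) *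
        ennreal (exp (- (norm (orth_part s x + (r / (s \<bullet> w)) *\<^sub>R w))\<^sup>2 / 2) / sqrt (2 * pi) ^ DIM('a))))
      \<partial>lborel) \<partial>lborel)"
    by (simp only: rw ind mult_ac)
  finally show ?thesis .
qed


section \<open>Bounding the exponent of a shifted Gaussian\<close>

text \<open>The AM-GM weight is \<open>\<omega> / sqrt k\<close>. For \<open>k = 0\<close> (dimension one) it is \<open>\<omega> / 0 = 0\<close>,
  and the bounds still hold because then \<open>r = 0\<close>.\<close>
lemma shift_exponent_bounds:
  fixes r \<omega> k t :: real
  assumes "r \<ge> 0" "\<omega> \<ge> 0" "k \<ge> 0" "k = 0 \<Longrightarrow> r = 0" "0 \<le> t" "t \<le> 1"
  shows "- (r\<^sup>2 - 2 * t * r * \<omega> + t\<^sup>2 * \<omega>\<^sup>2) \<le> sqrt k * \<omega> - r\<^sup>2 / (1 + \<omega> / sqrt k)"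
    and "- (r\<^sup>2 + 2 * t * r * \<omega> + t\<^sup>2 * \<omega>\<^sup>2) \<ge> - sqrt k * \<omega> - \<omega>\<^sup>2 - (1 + \<omega> / sqrt k) * r\<^sup>2"
proof -
  define q \<alpha> where "q = sqrt k" and "\<alpha> = \<omega> / q"
  have t2: "t\<^sup>2 \<le> 1" using assms by (simp add: power_le_one)
  have "- (r\<^sup>2 - 2 * t * r * \<omega> + t\<^sup>2 * \<omega>\<^sup>2) \<le> q * \<omega> - r\<^sup>2 / (1 + \<alpha>) \<and>
    - (r\<^sup>2 + 2 * t * r * \<omega> + t\<^sup>2 * \<omega>\<^sup>2) \<ge> - q * \<omega> - \<omega>\<^sup>2 - (1 + \<alpha>) * r\<^sup>2"
  proof (cases "k = 0")
    case True
    then have "t\<^sup>2 * \<omega>\<^sup>2 \<le> \<omega>\<^sup>2" using t2 by (simp add: mult_left_le_one_le)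
    then show ?thesis using True assms by (simp add: q_def)
  next
    case False
    then have q: "q > 0" and \<alpha>: "\<alpha> \<ge> 0" and \<omega>: "\<omega> = \<alpha> * q"
      using assms by (simp_all add: q_def \<alpha>_def)
    \<comment> \<open>AM-GM as a completed square. Of the last coefficient,
      \<open>\<alpha>\<^sup>2 * q\<^sup>2 * t\<^sup>2\<close> is
      \<open>t\<^sup>2 * \<omega>\<^sup>2\<close>, and
      \<open>\<alpha> * q\<^sup>2 * t\<^sup>2\<close> is at most
      \<open>\<alpha> * q\<^sup>2 = q * \<omega>\<close>.\<close>
    have "0 \<le> \<alpha> / (1 + \<alpha>) * (r - (1 + \<alpha>) * t * q)\<^sup>2" using \<alpha> by simp
    also have "\<dots> = \<alpha> / (1 + \<alpha>) * r\<^sup>2 - 2 * t * r * \<omega> + (\<alpha> + \<alpha>\<^sup>2) * q\<^sup>2 * t\<^sup>2"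
      using \<alpha> by (simp add: \<omega> field_simps power2_eq_square)
    also have "\<dots> \<le> \<alpha> / (1 + \<alpha>) * r\<^sup>2 - 2 * t * r * \<omega> + t\<^sup>2 * \<omega>\<^sup>2 + \<alpha> * q\<^sup>2"
      using mult_left_mono[OF t2, of "\<alpha> * q\<^sup>2"] \<alpha>
      by (simp add: \<omega> power_mult_distrib algebra_simps)
    also have "\<alpha> / (1 + \<alpha>) * r\<^sup>2 = r\<^sup>2 - r\<^sup>2 / (1 + \<alpha>)" using \<alpha> by (simp add: field_simps)
    finally have 1: "- (r\<^sup>2 - 2 * t * r * \<omega> + t\<^sup>2 * \<omega>\<^sup>2) \<le> q * \<omega> - r\<^sup>2 / (1 + \<alpha>)"
      by (simp add: \<omega> power2_eq_square mult_ac)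
    \<comment> \<open>AM-GM for \<open>2 * r * \<omega> = 2 * \<alpha> * r * q\<close>; the factors
      \<open>t\<close> are bounded by 1 afterwards.\<close>
    have "0 \<le> \<alpha> * (r - q)\<^sup>2" using \<alpha> by simp
    then have "2 * (r * \<omega>) \<le> \<alpha> * r\<^sup>2 + q * \<omega>"
      by (simp add: \<omega> power2_diff algebra_simps power2_eq_square)
    moreover have "t * (r * \<omega>) \<le> r * \<omega>" "t\<^sup>2 * \<omega>\<^sup>2 \<le> \<omega>\<^sup>2"
      using assms t2 by (simp_all add: mult_left_le_one_le)
    ultimately have 2: "- (r\<^sup>2 + 2 * t * r * \<omega> + t\<^sup>2 * \<omega>\<^sup>2) \<ge> - q * \<omega> - \<omega>\<^sup>2 - (1 + \<alpha>) * r\<^sup>2"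
      by (simp add: algebra_simps)
    show ?thesis using 1 2 by blast
  qed
  then show "- (r\<^sup>2 - 2 * t * r * \<omega> + t\<^sup>2 * \<omega>\<^sup>2) \<le> sqrt k * \<omega> - r\<^sup>2 / (1 + \<omega> / sqrt k)"
    and "- (r\<^sup>2 + 2 * t * r * \<omega> + t\<^sup>2 * \<omega>\<^sup>2) \<ge> - sqrt k * \<omega> - \<omega>\<^sup>2 - (1 + \<omega> / sqrt k) * r\<^sup>2"
    by (simp_all add: q_def \<alpha>_def)
qed

text \<open>Two nonzero orthogonal vectors would be an independent pair. This supplies the case
  \<open>k = 0\<close> of the exponent bounds.\<close>

lemma orthogonal_unit_DIM_1:
  fixes s y :: "'a::euclidean_space"
  assumes "norm s = 1" "s \<bullet> y = 0" "DIM('a) = 1"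
  shows "y = 0"
proof (rule ccontr)
  assume "y \<noteq> 0"
  moreover have "s \<noteq> 0" using assms by auto
  moreover have "s \<noteq> y" using assms by (auto simp: norm_eq_1)
  moreover have "pairwise orthogonal {s, y}"
    using assms by (auto simp: pairwise_def orthogonal_def inner_commute)
  ultimately have "independent {s, y}" by (intro pairwise_orthogonal_independent) auto
  then have "card {s, y} \<le> DIM('a)" by (rule independent_card_le)
  then show False using \<open>s \<noteq> y\<close> assms by simp
qed

text \<open>Cauchy-Schwarz bounds the cross term \<open>y \<bullet> w\<close>, which leaves the
  scalar inequality for \<open>r = norm y\<close> and \<open>\<omega> = norm w\<close>.\<close>

lemma norm_shift_bounds:
  fixes s y w :: "'a::euclidean_space"
  defines "k \<equiv> real DIM('a) - 1"
  assumes "norm s = 1" "s \<bullet> y = 0" "0 \<le> t" "t \<le> 1"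
  shows "- (norm (y + t *\<^sub>R w))\<^sup>2 \<le> sqrt k * norm w - (norm y)\<^sup>2 / (1 + norm w / sqrt k)"
    and "- (norm (y + t *\<^sub>R w))\<^sup>2 \<ge>
      - sqrt k * norm w - (norm w)\<^sup>2 - (1 + norm w / sqrt k) * (norm y)\<^sup>2"
proof -
  have "k \<ge> 0" using DIM_positive[where 'a='a] by (simp add: k_def Suc_leI)
  moreover have "norm y = 0" if "k = 0"
    using orthogonal_unit_DIM_1[OF assms(2,3)] that by (simp add: k_def)
  ultimately have b: "- ((norm y)\<^sup>2 - 2 * t * norm y * norm w + t\<^sup>2 * (norm w)\<^sup>2) \<le>
        sqrt k * norm w - (norm y)\<^sup>2 / (1 + norm w / sqrt k)"
      "- ((norm y)\<^sup>2 + 2 * t * norm y * norm w + t\<^sup>2 * (norm w)\<^sup>2) \<ge>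
        - sqrt k * norm w - (norm w)\<^sup>2 - (1 + norm w / sqrt k) * (norm y)\<^sup>2"
    using shift_exponent_bounds[of "norm y" "norm w" k t] assms by auto
  have "(norm (y + t *\<^sub>R w))\<^sup>2 = (norm y)\<^sup>2 + 2 * (t * (y \<bullet> w)) + t\<^sup>2 * (norm w)\<^sup>2"
    unfolding power2_norm_eq_inner
    by (simp add: inner_add_left inner_add_right inner_commute power2_eq_square)
  moreover have "\<bar>t * (y \<bullet> w)\<bar> \<le> t * (norm y * norm w)"
    using assms Cauchy_Schwarz_ineq2[of y w] by (simp add: abs_mult mult_left_mono)
  ultimately show "- (norm (y + t *\<^sub>R w))\<^sup>2 \<le> sqrt k * norm w - (norm y)\<^sup>2 / (1 + norm w / sqrt k)"
    and "- (norm (y + t *\<^sub>R w))\<^sup>2 \<ge>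
      - sqrt k * norm w - (norm w)\<^sup>2 - (1 + norm w / sqrt k) * (norm y)\<^sup>2"
    using b by (simp_all add: abs_le_iff)
qed

lemma nn_integral_slab_cmult:
  fixes s :: "'a::euclidean_space"
  assumes [measurable]: "T \<in> sets borel" and c: "c \<ge> 0"
  shows "(\<integral>\<^sup>+r. (\<integral>\<^sup>+x. indicator {0..<c} r * (ennreal (std_normal_density (s \<bullet> x)) *
      (indicator T (orth_part s x) *
        (C * ennreal (exp (- (l * (norm (orth_part s x))\<^sup>2 / 2)))))) \<partial>lborel) \<partial>lborel) =
    ennreal c * C * cone_integral s T l"
proof -
  have "(\<integral>\<^sup>+x. indicator {0..<c} r * (ennreal (std_normal_density (s \<bullet> x)) *
      (indicator T (orth_part s x) *
        (C * ennreal (exp (- (l * (norm (orth_part s x))\<^sup>2 / 2)))))) \<partial>lborel) =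
    (\<integral>\<^sup>+x. (indicator {0..<c} r * C) * (ennreal (std_normal_density (s \<bullet> x)) *
      (indicator T (orth_part s x) *
        ennreal (exp (- (l * (norm (orth_part s x))\<^sup>2 / 2))))) \<partial>lborel)" for r :: real
    by (simp only: mult_ac)
  also have "\<dots> r = (indicator {0..<c} r * C) * cone_integral s T l" for r
    unfolding cone_integral_def by (rule nn_integral_cmult) measurable
  finally have "(\<integral>\<^sup>+r. (\<integral>\<^sup>+x. indicator {0..<c} r * (ennreal (std_normal_density (s \<bullet> x)) *
      (indicator T (orth_part s x) *
        (C * ennreal (exp (- (l * (norm (orth_part s x))\<^sup>2 / 2)))))) \<partial>lborel) \<partial>lborel) =
      (\<integral>\<^sup>+r. (C * cone_integral s T l) * indicator {0..<c} r \<partial>lborel)"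
    by (simp only: mult_ac)
  also have "\<dots> = (C * cone_integral s T l) * ennreal c"
    using c by (subst nn_integral_cmult_indicator) simp_all
  finally show ?thesis by (simp only: mult_ac)
qed

text \<open>From \<open>1 + \<alpha> \<le> exp \<alpha>\<close> with
  \<open>\<alpha> = \<omega> / sqrt k\<close>, since
  \<open>k * \<alpha> = sqrt k * \<omega>\<close>. For \<open>k = 0\<close> both sides are
  1.\<close>

lemma sqrt_power_le_exp:
  assumes "\<omega> \<ge> 0"
  shows "sqrt (1 + \<omega> / sqrt (real k)) ^ k \<le> exp (sqrt (real k) * \<omega> / 2)"
proof -
  define \<alpha> where "\<alpha> = \<omega> / sqrt (real k)"
  have "\<alpha> \<ge> 0" using assms by (simp add: \<alpha>_def)
  have "sqrt (1 + \<alpha>) \<le> sqrt (exp \<alpha>)" using exp_ge_add_one_self[of \<alpha>] by simp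
  also have "\<dots> = exp (\<alpha> / 2)"
    by (rule real_sqrt_unique) (simp_all add: power2_eq_square exp_add[symmetric])
  finally have "sqrt (1 + \<alpha>) ^ k \<le> exp (\<alpha> / 2) ^ k"
    using \<open>\<alpha> \<ge> 0\<close> by (intro power_mono) auto
  also have "\<dots> = exp (real k * \<alpha> / 2)" by (simp add: exp_of_nat_mult[symmetric])
  also have "real k * \<alpha> = sqrt (real k) * \<omega>"
    using real_sqrt_mult_self[of "real k"] by (cases "k = 0") (simp_all add: \<alpha>_def field_simps)
  finally show ?thesis by (simp add: \<alpha>_def)
qed

lemma DIM_minus_1: "real (DIM('a::euclidean_space) - 1) = real DIM('a) - 1"
  using DIM_positive[where 'a='a] by (simp add: of_nat_diff Suc_leI)

text \<open>With \<open>m\<^sup>2 = 1 + norm w / sqrt k\<close>, the comparison of exponents costs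
  \<open>exp (sqrt k * norm w / 2)\<close>, and rescaling the cone costs \<open>m ^ d\<close>, which
  is at most the same again. The lower bound mirrors this with \<open>m\<close> in place of
  \<open>inverse m\<close> and keeps the term \<open>(norm w)\<^sup>2 / 2\<close>.\<close>

lemma
  fixes s w :: "'a::euclidean_space"
  assumes T [measurable]: "T \<in> sets borel" and s: "norm s = 1" and c: "s \<bullet> w > 0"
    and cone: "\<And>y c. c > 0 \<Longrightarrow> c *\<^sub>R y \<in> T \<longleftrightarrow> y \<in> T"
  defines "k \<equiv> real DIM('a) - 1" and "\<rho> \<equiv> measure std_gaussian {x. orth_part s x \<in> T}"
  shows measure_slab_le: "measure std_gaussian (slab s w T) \<le>
      s \<bullet> w / sqrt (2 * pi) * \<rho> * exp (sqrt k * norm w)" (is ?upper)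
    and measure_slab_ge: "measure std_gaussian (slab s w T) \<ge>
      s \<bullet> w / sqrt (2 * pi) * \<rho> * exp (- sqrt k * norm w - (norm w)\<^sup>2 / 2)" (is ?lower)
proof -
  define d where "d = DIM('a) - 1"
  define m where "m = sqrt (1 + norm w / sqrt k)"
  define C where "C = inverse (sqrt (2 * pi) ^ DIM('a))"
  define p where "p = sqrt (2 * pi)"
  have k: "k = real d" by (simp add: k_def d_def DIM_minus_1)
  have C: "C > 0" by (simp add: C_def)
  have G: "y / sqrt (2 * pi) ^ DIM('a) = C * y" for y by (simp add: C_def p_def divide_inverse)
  have p: "p > 0" by (simp add: p_def)
  have "\<rho> \<ge> 0" by (simp add: \<rho>_def)
  have m2: "m\<^sup>2 = 1 + norm w / sqrt k" and m: "m > 0" using k by (simp_all add: m_def add_pos_nonneg)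
  have nonneg: "0 \<le> C * exp u" "0 \<le> p ^ d * \<rho> / m ^ d" "0 \<le> p ^ d * \<rho> / inverse m ^ d" for u
    using C p m \<open>\<rho> \<ge> 0\<close> by simp_all
  have md: "m ^ d \<le> exp (sqrt k * norm w / 2)"
    unfolding m_def k by (rule sqrt_power_le_exp) simp
  \<comment> \<open>Of the \<open>DIM('a)\<close> factors in \<open>C\<close>, the hyperplane
    integral cancels all but one; the last is the \<open>1 / sqrt (2 * pi)\<close> of the
    bound.\<close>
  have Cd: "C * p ^ d = 1 / p"
    using power_minus_mult[OF DIM_positive[where 'a='a], of p] p
    unfolding C_def d_def p_def[symmetric] by (simp add: field_simps)
  have K1: "cone_integral s T 1 = ennreal (p ^ d * \<rho>)"
    using cone_integral_1[OF T s] by (simp add: p_def d_def \<rho>_def)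
  have Km: "ennreal (m' ^ d) * cone_integral s T (m'\<^sup>2) = ennreal (p ^ d * \<rho>)" if "m' > 0" for m'
    using cone_integral_scale[OF T s that cone] K1 by (simp add: d_def)
  \<comment> \<open>Used with \<open>m' = inverse m\<close> for the upper and \<open>m' = m\<close>
    for the lower bound.\<close>
  have K: "cone_integral s T (m'\<^sup>2) = ennreal (p ^ d * \<rho> / m' ^ d)" if "m' > 0" for m'
  proof -
    have "cone_integral s T (m'\<^sup>2) = ennreal (inverse (m' ^ d)) * (ennreal (m' ^ d) * cone_integral s T (m'\<^sup>2))"
      using that by (simp add: mult.assoc[symmetric] ennreal_mult[symmetric])
    also have "\<dots> = ennreal (p ^ d * \<rho> / m' ^ d)"
      unfolding Km[OF that] using that p \<open>\<rho> \<ge> 0\<close>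
      by (simp add: ennreal_mult[symmetric] field_simps)
    finally show ?thesis .
  qed
  \<comment> \<open>Up to a constant, the shifted Gaussian is dominated by a wider centred one,
    whose integral over the cone is known.\<close>
  have "emeasure std_gaussian (slab s w T) \<le>
    (\<integral>\<^sup>+r. (\<integral>\<^sup>+x. indicator {0..<s \<bullet> w} r * (ennreal (std_normal_density (s \<bullet> x)) *
      (indicator T (orth_part s x) * (ennreal (C * exp (sqrt k * norm w / 2)) *
      ennreal (exp (- ((inverse m)\<^sup>2 * (norm (orth_part s x))\<^sup>2 / 2)))))) \<partial>lborel) \<partial>lborel)"
    unfolding emeasure_slab[OF T s c]
  proof (intro nn_integral_mono)
    fix r x
    show "indicator {0..<s \<bullet> w} r * (ennreal (std_normal_density (s \<bullet> x)) * (indicator T (orth_part s x) *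
        ennreal (exp (- (norm (orth_part s x + (r / (s \<bullet> w)) *\<^sub>R w))\<^sup>2 / 2) / sqrt (2 * pi) ^ DIM('a))))
      \<le> indicator {0..<s \<bullet> w} r * (ennreal (std_normal_density (s \<bullet> x)) *
      (indicator T (orth_part s x) * (ennreal (C * exp (sqrt k * norm w / 2)) *
      ennreal (exp (- ((inverse m)\<^sup>2 * (norm (orth_part s x))\<^sup>2 / 2))))))"
    proof (cases "r \<in> {0..<s \<bullet> w}")
      case True
      then have t: "0 \<le> r / (s \<bullet> w)" "r / (s \<bullet> w) \<le> 1" using c by simp_all
      have "- (norm (orth_part s x + (r / (s \<bullet> w)) *\<^sub>R w))\<^sup>2 \<le>
          sqrt k * norm w - (inverse m)\<^sup>2 * (norm (orth_part s x))\<^sup>2"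
        using norm_shift_bounds(1)[OF s inner_orth_part[OF s, of x] t, of w]
        by (simp add: k_def[symmetric] m2 power_inverse divide_inverse mult.commute)
      then have "exp (- (norm (orth_part s x + (r / (s \<bullet> w)) *\<^sub>R w))\<^sup>2 / 2) \<le>
          exp (sqrt k * norm w / 2) * exp (- ((inverse m)\<^sup>2 * (norm (orth_part s x))\<^sup>2 / 2))"
        unfolding exp_add[symmetric] exp_le_cancel_iff by linarith
      then have "C * exp (- (norm (orth_part s x + (r / (s \<bullet> w)) *\<^sub>R w))\<^sup>2 / 2) \<le>
          C * (exp (sqrt k * norm w / 2) * exp (- ((inverse m)\<^sup>2 * (norm (orth_part s x))\<^sup>2 / 2)))"
        using C by (intro mult_left_mono) auto
      then have "ennreal (exp (- (norm (orth_part s x + (r / (s \<bullet> w)) *\<^sub>R w))\<^sup>2 / 2) / sqrt (2 * pi) ^ DIM('a)) \<le>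
          ennreal (C * exp (sqrt k * norm w / 2)) * ennreal (exp (- ((inverse m)\<^sup>2 * (norm (orth_part s x))\<^sup>2 / 2)))"
        unfolding G using C by (subst ennreal_mult[symmetric]) (auto simp: mult.assoc intro!: ennreal_leI)
      then show ?thesis by (intro mult_left_mono) simp_all
    qed simp
  qed
  also have "\<dots> = ennreal (s \<bullet> w) * ennreal (C * exp (sqrt k * norm w / 2)) *
      ennreal (p ^ d * \<rho> / inverse m ^ d)"
    by (simp only: nn_integral_slab_cmult[OF T less_imp_le[OF c]] K[OF positive_imp_inverse_positive[OF m]])
  also have "\<dots> = ennreal (s \<bullet> w * (C * p ^ d) * \<rho> * (m ^ d * exp (sqrt k * norm w / 2)))"
  proof -
    have "s \<bullet> w * (C * exp (sqrt k * norm w / 2)) * (p ^ d * \<rho> / inverse m ^ d) =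
        s \<bullet> w * (C * p ^ d) * \<rho> * (m ^ d * exp (sqrt k * norm w / 2))"
      by (simp only: power_inverse divide_inverse inverse_inverse_eq mult_ac)
    then show ?thesis
      by (simp only: ennreal_mult''[symmetric] nonneg)
  qed
  finally have "measure std_gaussian (slab s w T) \<le>
      s \<bullet> w * (C * p ^ d) * \<rho> * (m ^ d * exp (sqrt k * norm w / 2))"
    using c m C p \<open>\<rho> \<ge> 0\<close> by (simp add: std_gaussian.emeasure_eq_measure)
  also have "\<dots> \<le> s \<bullet> w * (C * p ^ d) * \<rho> * (exp (sqrt k * norm w / 2) * exp (sqrt k * norm w / 2))"
    using c C p \<open>\<rho> \<ge> 0\<close> md by (intro mult_left_mono mult_right_mono) auto
  finally show ?upper
    unfolding Cd by (simp add: exp_add[symmetric] p_def)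

  \<comment> \<open>In reverse, a multiple of a narrower centred Gaussian lies below the shifted
    one.\<close>
  have "ennreal (s \<bullet> w * (C * p ^ d) * \<rho> * (inverse (m ^ d) * exp (- sqrt k * norm w / 2 - (norm w)\<^sup>2 / 2))) =
    ennreal (s \<bullet> w) * ennreal (C * exp (- sqrt k * norm w / 2 - (norm w)\<^sup>2 / 2)) *
      ennreal (p ^ d * \<rho> / m ^ d)"
  proof -
    have "s \<bullet> w * (C * exp (- sqrt k * norm w / 2 - (norm w)\<^sup>2 / 2)) * (p ^ d * \<rho> / m ^ d) =
        s \<bullet> w * (C * p ^ d) * \<rho> * (inverse (m ^ d) * exp (- sqrt k * norm w / 2 - (norm w)\<^sup>2 / 2))"
      by (simp only: divide_inverse mult_ac)
    then show ?thesis
      by (simp only: ennreal_mult''[symmetric] nonneg)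
  qed
  also have "\<dots> = (\<integral>\<^sup>+r. (\<integral>\<^sup>+x. indicator {0..<s \<bullet> w} r * (ennreal (std_normal_density (s \<bullet> x)) *
      (indicator T (orth_part s x) * (ennreal (C * exp (- sqrt k * norm w / 2 - (norm w)\<^sup>2 / 2)) *
      ennreal (exp (- (m\<^sup>2 * (norm (orth_part s x))\<^sup>2 / 2)))))) \<partial>lborel) \<partial>lborel)"
    by (simp only: nn_integral_slab_cmult[OF T less_imp_le[OF c]] K[OF m])
  also have "\<dots> \<le> emeasure std_gaussian (slab s w T)"
    unfolding emeasure_slab[OF T s c]
  proof (intro nn_integral_mono)
    fix r x
    show "indicator {0..<s \<bullet> w} r * (ennreal (std_normal_density (s \<bullet> x)) *
      (indicator T (orth_part s x) * (ennreal (C * exp (- sqrt k * norm w / 2 - (norm w)\<^sup>2 / 2)) *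
      ennreal (exp (- (m\<^sup>2 * (norm (orth_part s x))\<^sup>2 / 2))))))
      \<le> indicator {0..<s \<bullet> w} r * (ennreal (std_normal_density (s \<bullet> x)) * (indicator T (orth_part s x) *
        ennreal (exp (- (norm (orth_part s x + (r / (s \<bullet> w)) *\<^sub>R w))\<^sup>2 / 2) / sqrt (2 * pi) ^ DIM('a))))"
    proof (cases "r \<in> {0..<s \<bullet> w}")
      case True
      then have t: "0 \<le> r / (s \<bullet> w)" "r / (s \<bullet> w) \<le> 1" using c by simp_all
      have "- (norm (orth_part s x + (r / (s \<bullet> w)) *\<^sub>R w))\<^sup>2 \<ge>
          - sqrt k * norm w - (norm w)\<^sup>2 - m\<^sup>2 * (norm (orth_part s x))\<^sup>2"
        using norm_shift_bounds(2)[OF s inner_orth_part[OF s, of x] t, of w]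
        by (simp add: k_def[symmetric] m2)
      then have "exp (- sqrt k * norm w / 2 - (norm w)\<^sup>2 / 2) * exp (- (m\<^sup>2 * (norm (orth_part s x))\<^sup>2 / 2))
          \<le> exp (- (norm (orth_part s x + (r / (s \<bullet> w)) *\<^sub>R w))\<^sup>2 / 2)"
        unfolding exp_add[symmetric] exp_le_cancel_iff by linarith
      then have "C * (exp (- sqrt k * norm w / 2 - (norm w)\<^sup>2 / 2) * exp (- (m\<^sup>2 * (norm (orth_part s x))\<^sup>2 / 2)))
          \<le> C * exp (- (norm (orth_part s x + (r / (s \<bullet> w)) *\<^sub>R w))\<^sup>2 / 2)"
        using C by (intro mult_left_mono) auto
      then have "ennreal (C * exp (- sqrt k * norm w / 2 - (norm w)\<^sup>2 / 2)) * ennreal (exp (- (m\<^sup>2 * (norm (orth_part s x))\<^sup>2 / 2)))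
          \<le> ennreal (exp (- (norm (orth_part s x + (r / (s \<bullet> w)) *\<^sub>R w))\<^sup>2 / 2) / sqrt (2 * pi) ^ DIM('a))"
        unfolding G using C by (subst ennreal_mult[symmetric]) (auto simp: mult.assoc intro!: ennreal_leI)
      then show ?thesis by (intro mult_left_mono) simp_all
    qed simp
  qed
  finally have "s \<bullet> w * (C * p ^ d) * \<rho> * (inverse (m ^ d) * exp (- sqrt k * norm w / 2 - (norm w)\<^sup>2 / 2))
      \<le> measure std_gaussian (slab s w T)"
    using c m C p \<open>\<rho> \<ge> 0\<close> by (simp add: std_gaussian.emeasure_eq_measure)
  moreover have "inverse (m ^ d) \<ge> exp (- (sqrt k * norm w / 2))"
    unfolding exp_minus using md m by (intro le_imp_inverse_le) auto
  then have "s \<bullet> w * (C * p ^ d) * \<rho> * (exp (- (sqrt k * norm w / 2)) * exp (- sqrt k * norm w / 2 - (norm w)\<^sup>2 / 2))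
    \<le> s \<bullet> w * (C * p ^ d) * \<rho> * (inverse (m ^ d) * exp (- sqrt k * norm w / 2 - (norm w)\<^sup>2 / 2))"
    using c C p \<open>\<rho> \<ge> 0\<close> by (intro mult_left_mono mult_right_mono) auto
  ultimately show ?lower
    unfolding Cd by (simp add: exp_add[symmetric] p_def)
qed

section \<open>Margins of polyhedral cones\<close>

text \<open>Links the projection in \<open>gauss_rel\<close> to \<open>orth_part\<close>: by
  Cauchy-Schwarz every point of the hyperplane has distance at least
  \<open>\<bar>s \<bullet> x\<bar>\<close> from \<open>x\<close>.\<close>

lemma closest_point_hyperplane:
  fixes s :: "'a::euclidean_space"
  assumes "norm s = 1"
  shows "closest_point {y. s \<bullet> y = 0} x = orth_part s x"
proof (rule closest_point_unique[symmetric])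
  show "convex {y. s \<bullet> y = 0}" by (rule convex_hyperplane)
  show "closed {y. s \<bullet> y = 0}" by (rule closed_hyperplane)
  show "orth_part s x \<in> {y. s \<bullet> y = 0}" by (simp add: inner_orth_part assms)
  show "\<forall>z\<in>{y. s \<bullet> y = 0}. dist x (orth_part s x) \<le> dist x z"
  proof
    fix z assume "z \<in> {y. s \<bullet> y = 0}"
    then have "\<bar>s \<bullet> x\<bar> = \<bar>s \<bullet> (x - z)\<bar>" by (simp add: inner_diff_right)
    also have "\<dots> \<le> norm (x - z)" using Cauchy_Schwarz_ineq2[of s "x - z"] assms by simp
    finally show "dist x (orth_part s x) \<le> dist x z"
      using assms by (simp add: dist_norm orth_part_def)
  qed
qed

text \<open>The properties of a normal cone at a vertex on which the margin estimates rest.\<close>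

locale solid_polyhedral_cone =
  fixes N :: "'a::euclidean_space set"
  assumes polyhedron: "polyhedron N" and cone: "cone N" and solid: "interior N \<noteq> {}"
begin

section \<open>Facets and their inward normals\<close>

lemma zero_mem: "0 \<in> N"
  using cone solid interior_subset cone_contains_0 by blast

lemma scaleR_mem_iff: "c > 0 \<Longrightarrow> c *\<^sub>R y \<in> N \<longleftrightarrow> y \<in> N"
  using cone unfolding cone_def
  by (metis less_imp_le scaleR_one scaleR_scaleR left_inverse less_irrefl positive_imp_inverse_positive)

lemma add_mem: "x \<in> N \<Longrightarrow> y \<in> N \<Longrightarrow> x + y \<in> N"
  using polyhedron_imp_convex[OF polyhedron] cone convex_cone by blast

text \<open>A step of length \<open>e\<close> against \<open>s\<close> stays in \<open>N\<close> and
  lowers the inner product with \<open>s\<close> by \<open>e\<close>.\<close>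

lemma interior_pos:
  assumes "norm s = 1" "\<forall>y\<in>N. s \<bullet> y \<ge> 0" "p \<in> interior N"
  shows "s \<bullet> p > 0"
proof -
  obtain e where e: "e > 0" "cball p e \<subseteq> N" using assms(3) mem_interior_cball by blast
  then have "p - e *\<^sub>R s \<in> N" using assms(1) by (intro subsetD[OF e(2)]) (simp add: dist_norm)
  then have "0 \<le> s \<bullet> (p - e *\<^sub>R s)" using assms by blast
  also have "\<dots> = s \<bullet> p - e" using assms(1) by (simp add: inner_diff_right norm_eq_1)
  finally show ?thesis using e by simp
qed

lemma aff_dim_eq: "aff_dim N = int DIM('a)"
  using solid by (simp add: aff_dim_nonempty_interior)

text \<open>The condition under \<open>THE\<close> in \<open>inward_normal\<close>, named so that
  existence and uniqueness can be proved for it.\<close>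

definition is_normal :: "'a \<Rightarrow> 'a set \<Rightarrow> bool" where
  "is_normal s T \<longleftrightarrow> norm s = 1 \<and> (\<forall>y\<in>N. s \<bullet> y \<ge> 0) \<and> T = {y \<in> N. s \<bullet> y = 0}"

lemma is_normal_exists:
  assumes "T \<in> facets N"
  shows "\<exists>s. is_normal s T"
proof -
  have T: "T face_of N" "T \<noteq> {}" "aff_dim T = aff_dim N - 1"
    using assms by (auto simp: facets_def facet_of_def)
  then obtain a b where ab: "N \<subseteq> {x. a \<bullet> x \<le> b}" "T = N \<inter> {x. a \<bullet> x = b}"
    using exposed_face_of_polyhedron[OF polyhedron, of T] unfolding exposed_face_of_def by blast
  obtain y where y: "y \<in> N" "a \<bullet> y = b" using T(2) ab(2) by blast
  \<comment> \<open>The supporting hyperplane passes through 0 because \<open>N\<close> is a cone: 0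
    gives \<open>b \<ge> 0\<close>, and \<open>2 *\<^sub>R y\<close> gives
    \<open>2 * b \<le> b\<close>.\<close>
  have "b \<ge> 0" using zero_mem ab(1) by auto
  moreover have "2 *\<^sub>R y \<in> N" using y scaleR_mem_iff[of 2 y] by simp
  then have "a \<bullet> (2 *\<^sub>R y) \<le> b" using ab(1) by blast
  ultimately have b: "b = 0" using y by simp
  have a: "a \<noteq> 0"
  proof
    assume "a = 0"
    then have "T = N" using ab b by auto
    then show False using T(3) by simp
  qed
  have "is_normal (- (a /\<^sub>R norm a)) T"
    using a ab b unfolding is_normal_def by (auto simp: mult_nonneg_nonpos)
  then show ?thesis ..
qed

text \<open>A dimension count: \<open>0 \<in> T\<close>, so the linear dimension of \<open>T\<close>
  is its affine dimension, one less than that of the space.\<close>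

lemma span_facet:
  assumes "T \<in> facets N" "is_normal s T"
  shows "span T = {y. s \<bullet> y = 0}"
proof (rule subspace_dim_equal)
  have s: "s \<noteq> 0" using assms(2) by (auto simp: is_normal_def)
  have "0 \<in> T" using assms(2) zero_mem by (simp add: is_normal_def)
  then have "int (dim T) = aff_dim T" using aff_dim_zero hull_inc by metis
  also have "\<dots> = int DIM('a) - 1"
    using assms(1) aff_dim_eq by (simp add: facets_def facet_of_def)
  finally have "dim T = DIM('a) - 1" by linarith
  then show "dim {y. s \<bullet> y = 0} \<le> dim (span T)" using s by (simp add: dim_hyperplane)
  show "span T \<subseteq> {y. s \<bullet> y = 0}"
    by (rule span_minimal) (use assms(2) in \<open>auto simp: is_normal_def subspace_hyperplane\<close>)
qed (auto simp: subspace_hyperplane)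

text \<open>Both vectors are orthogonal to the same hyperplane, hence parallel; an interior point of
  \<open>N\<close> fixes the sign.\<close>

lemma is_normal_unique:
  assumes T: "T \<in> facets N" and s: "is_normal s T" "is_normal t T"
  shows "s = t"
proof -
  have ns: "norm s = 1" "norm t = 1" using s by (simp_all add: is_normal_def)
  have eq: "{y. s \<bullet> y = 0} = {y. t \<bullet> y = 0}" using span_facet[OF T] s by blast
  have "s \<bullet> orth_part s t = 0" by (rule inner_orth_part[OF ns(1)])
  then have "t \<bullet> orth_part s t = 0" using eq by blast
  then have "orth_part s t \<bullet> orth_part s t = 0"
    using \<open>s \<bullet> orth_part s t = 0\<close> by (simp add: orth_part_def inner_diff_left)
  then have ts: "t = (s \<bullet> t) *\<^sub>R s" by (simp add: orth_part_def)
  obtain p where "p \<in> interior N" using solid by blast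
  then have "s \<bullet> p > 0" "t \<bullet> p > 0" using interior_pos s by (auto simp: is_normal_def)
  moreover have "t \<bullet> p = (s \<bullet> t) * (s \<bullet> p)" by (subst ts) simp
  ultimately have "s \<bullet> t > 0" by (simp add: zero_less_mult_iff)
  moreover have "\<bar>s \<bullet> t\<bar> = 1" using arg_cong[OF ts, of norm] ns by simp
  ultimately show ?thesis using ts by simp
qed

lemma is_normal_inward_normal:
  assumes "T \<in> facets N"
  shows "is_normal (inward_normal N T) T"
proof -
  obtain s where s: "is_normal s T" using is_normal_exists[OF assms] ..
  then have "(THE s. is_normal s T) = s"
    by (rule the_equality) (rule is_normal_unique[OF assms _ s])
  then have "is_normal (THE s. is_normal s T) T" using s by simp
  then show ?thesis by (simp add: is_normal_def inward_normal_def)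
qed

lemma
  assumes "T \<in> facets N"
  shows norm_inward_normal: "norm (inward_normal N T) = 1"
    and inward_normal_nonneg: "y \<in> N \<Longrightarrow> inward_normal N T \<bullet> y \<ge> 0"
    and mem_facet_iff: "y \<in> T \<longleftrightarrow> y \<in> N \<and> inward_normal N T \<bullet> y = 0"
  using is_normal_inward_normal[OF assms] by (auto simp: is_normal_def)

lemma gauss_rel_facet:
  assumes "T \<in> facets N"
  shows "gauss_rel T = measure std_gaussian {x. orth_part (inward_normal N T) x \<in> T}"
  unfolding gauss_rel_def span_facet[OF assms is_normal_inward_normal[OF assms]]
  by (simp add: closest_point_hyperplane norm_inward_normal[OF assms])

lemma facet_borel: "T \<in> facets N \<Longrightarrow> T \<in> sets borel"
  using face_of_polyhedron_polyhedron[OF polyhedron]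
  by (auto simp: facets_def facet_of_def intro!: borel_closed polyhedron_imp_closed)

lemma N_borel: "N \<in> sets borel"
  using polyhedron by (intro borel_closed polyhedron_imp_closed)

lemma finite_facets: "finite (facets N)"
  unfolding facets_def by (rule finite_polyhedron_facets[OF polyhedron])

lemma facet_scaleR_mem_iff: "T \<in> facets N \<Longrightarrow> c > 0 \<Longrightarrow> c *\<^sub>R y \<in> T \<longleftrightarrow> y \<in> T"
  by (simp add: mem_facet_iff scaleR_mem_iff)

text \<open>If \<open>x\<close> lay outside, the segment from an interior point \<open>p\<close> to
  \<open>x\<close> would meet a facet. The normal there is positive at \<open>p\<close> and
  nonnegative at \<open>x\<close>, so it can vanish only at the endpoint \<open>x\<close>, which
  then lies in the facet.\<close>

lemma mem_iff: "x \<in> N \<longleftrightarrow> (\<forall>T\<in>facets N. inward_normal N T \<bullet> x \<ge> 0)"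
proof (intro iffI ballI)
  assume *: "\<forall>T\<in>facets N. inward_normal N T \<bullet> x \<ge> 0"
  show "x \<in> N"
  proof (rule ccontr)
    assume x: "x \<notin> N"
    obtain p where p: "p \<in> interior N" using solid by blast
    have "closed_segment p x \<inter> frontier N \<noteq> {}"
      using p x interior_subset
      by (intro connected_Int_frontier connected_segment) (auto simp: disjoint_iff)
    then obtain u where u: "0 \<le> u" "u \<le> 1" and f: "(1 - u) *\<^sub>R p + u *\<^sub>R x \<in> frontier N"
      by (auto simp: in_segment)
    have "frontier N = rel_frontier N" using solid by (simp add: rel_frontier_nonempty_interior)
    then obtain T where T: "T \<in> facets N" "(1 - u) *\<^sub>R p + u *\<^sub>R x \<in> T"
      using f rel_frontier_of_polyhedron[OF polyhedron] by (auto simp: facets_def)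
    have pos: "inward_normal N T \<bullet> p > 0"
      using interior_pos[OF _ _ p] T(1) norm_inward_normal inward_normal_nonneg by blast
    have "(1 - u) * (inward_normal N T \<bullet> p) + u * (inward_normal N T \<bullet> x) = 0"
      using T mem_facet_iff[OF T(1)] by (simp add: inner_add_right)
    moreover have "u * (inward_normal N T \<bullet> x) \<ge> 0" using * T(1) u by simp
    moreover have "(1 - u) * (inward_normal N T \<bullet> p) \<ge> 0" using u pos by simp
    ultimately have "u = 1" using pos by (simp add: add_nonneg_eq_0_iff)
    then show False using T x mem_facet_iff by simp
  qed
qed (rule inward_normal_nonneg)

section \<open>The margin of a single vector and its slabs\<close>

lemma margin_singleton: "x \<in> margin N {w} \<longleftrightarrow> x \<in> N \<and> x - w \<notin> N"
  by (force simp: margin_def set_plus_def)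

lemma margin_subset_slabs:
  "margin N {w} \<subseteq> (\<Union>T\<in>{T\<in>facets N. inward_normal N T \<bullet> w > 0}. slab (inward_normal N T) w T)"
proof
  fix x assume "x \<in> margin N {w}"
  then have x: "x \<in> N" "x - w \<notin> N" by (simp_all add: margin_singleton)
  define F where "F = {T\<in>facets N. inward_normal N T \<bullet> w > 0}"
  \<comment> \<open>The time at which \<open>x - t w\<close> reaches the hyperplane of
    \<open>T\<close>. A facet of \<open>F\<close> with minimal time is the one through which the
    path leaves \<open>N\<close>.\<close>
  define t where "t T = (inward_normal N T \<bullet> x) / (inward_normal N T \<bullet> w)" for T
  obtain T0 where T0: "T0 \<in> facets N" "inward_normal N T0 \<bullet> x < inward_normal N T0 \<bullet> w"
    using x(2) by (auto simp: mem_iff inner_diff_right not_le)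
  then have "inward_normal N T0 \<bullet> w > 0" using inward_normal_nonneg[OF T0(1) x(1)] by linarith
  then have "T0 \<in> F" "t T0 < 1" using T0 by (simp_all add: F_def t_def)
  moreover have "finite F" using finite_facets by (simp add: F_def)
  ultimately obtain T where T: "T \<in> F" and min: "\<And>T'. T' \<in> F \<Longrightarrow> t T \<le> t T'"
    using arg_min_if_finite(1)[of F t] arg_min_least[of F _ t] by (metis empty_iff)
  have TN: "T \<in> facets N" "inward_normal N T \<bullet> w > 0" using T by (auto simp: F_def)
  have "0 \<le> t T" using TN inward_normal_nonneg[OF TN(1) x(1)] by (simp add: t_def)
  moreover have "t T < 1" using min[OF \<open>T0 \<in> F\<close>] \<open>t T0 < 1\<close> by linarith
  ultimately have t: "0 \<le> t T" "t T < 1" .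
  \<comment> \<open>At the first exit time no constraint is violated: those in \<open>F\<close> by
    minimality, the others because they do not decrease along \<open>- w\<close>.\<close>
  have "x - t T *\<^sub>R w \<in> N"
    unfolding mem_iff
  proof
    fix T' assume T': "T' \<in> facets N"
    have nn: "inward_normal N T' \<bullet> x \<ge> 0" using inward_normal_nonneg[OF T' x(1)] .
    show "0 \<le> inward_normal N T' \<bullet> (x - t T *\<^sub>R w)"
    proof (cases "inward_normal N T' \<bullet> w > 0")
      case True
      then have "t T \<le> t T'" using T' min by (simp add: F_def)
      then show ?thesis using True by (simp add: inner_diff_right t_def[of T'] pos_le_divide_eq)
    next
      case False
      then have "t T * (inward_normal N T' \<bullet> w) \<le> 0" using t by (simp add: mult_nonneg_nonpos)
      then show ?thesis using nn by (simp add: inner_diff_right)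
    qed
  qed
  moreover have "inward_normal N T \<bullet> (x - t T *\<^sub>R w) = 0"
    using TN by (simp add: inner_diff_right t_def)
  ultimately have "x \<in> slab (inward_normal N T) w T"
    using t TN by (simp add: slab_def mem_facet_iff t_def[symmetric] inward_normal_nonneg x)
      (simp add: t_def)
  then show "x \<in> (\<Union>T\<in>F. slab (inward_normal N T) w T)" using T by blast
qed

text \<open>A point of the slab is a sum of the members \<open>x - t w\<close> and
  \<open>t w\<close> of \<open>N\<close>, while \<open>x - w\<close> violates the constraint of
  \<open>T\<close>.\<close>

lemma slab_subset_margin:
  assumes w: "w \<in> N" and T: "T \<in> facets N" and pos: "inward_normal N T \<bullet> w > 0"
  shows "slab (inward_normal N T) w T \<subseteq> margin N {w}"
proof
  fix x assume x: "x \<in> slab (inward_normal N T) w T"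
  define t where "t = (inward_normal N T \<bullet> x) / (inward_normal N T \<bullet> w)"
  have "0 \<le> t" and lt: "inward_normal N T \<bullet> x < inward_normal N T \<bullet> w" and "x - t *\<^sub>R w \<in> N"
    using x pos by (auto simp: slab_def t_def mem_facet_iff[OF T])
  moreover have "t *\<^sub>R w \<in> N" using \<open>0 \<le> t\<close> w cone by (simp add: cone_def)
  ultimately have "x \<in> N" using add_mem[of "x - t *\<^sub>R w" "t *\<^sub>R w"] by simp
  moreover have "x - w \<notin> N" using inward_normal_nonneg[OF T, of "x - w"] lt
    by (auto simp: inner_diff_right)
  ultimately show "x \<in> margin N {w}" by (simp add: margin_singleton)
qed

text \<open>For two facets with normals \<open>s\<close> and \<open>t\<close>, the slabs meet within the hyperplane
  orthogonal to the combination of \<open>s\<close> and \<open>t\<close> that annihilates \<open>w\<close>.\<close>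
lemma slab_Int_null:
  assumes T: "T \<in> facets N" "U \<in> facets N" "T \<noteq> U"
    and pos: "inward_normal N T \<bullet> w > 0" "inward_normal N U \<bullet> w > 0"
  shows "slab (inward_normal N T) w T \<inter> slab (inward_normal N U) w U \<in> null_sets std_gaussian"
proof -
  define s t where "s = inward_normal N T" and "t = inward_normal N U"
  have n: "norm s = 1" "norm t = 1" using norm_inward_normal T by (simp_all add: s_def t_def)
  have p: "s \<bullet> w > 0" "t \<bullet> w > 0" using pos by (simp_all add: s_def t_def)
  define q where "q = (t \<bullet> w) *\<^sub>R s - (s \<bullet> w) *\<^sub>R t"
  \<comment> \<open>Positively proportional unit normals coincide, and then so do their
    facets.\<close>
  have "q \<noteq> 0"
  proof
    assume "q = 0"
    then have eq: "(t \<bullet> w) *\<^sub>R s = (s \<bullet> w) *\<^sub>R t" by (simp add: q_def)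
    then have "norm ((t \<bullet> w) *\<^sub>R s) = norm ((s \<bullet> w) *\<^sub>R t)" by (rule arg_cong)
    then have "t \<bullet> w = s \<bullet> w"
      using p n by (simp only: norm_scaleR abs_of_pos mult_1_right)
    then have "(s \<bullet> w) *\<^sub>R s = (s \<bullet> w) *\<^sub>R t" using eq by (simp only:)
    then have "s = t" unfolding scaleR_cancel_left using p by simp
    then have "y \<in> T \<longleftrightarrow> y \<in> U" for y
      using mem_facet_iff[OF T(1), of y] mem_facet_iff[OF T(2), of y] by (simp add: s_def t_def)
    then have "T = U" by blast
    then show False using T by simp
  qed
  have sub: "slab s w T \<inter> slab t w U \<subseteq> {x. q \<bullet> x = 0}"
  proof safe
    fix x assume x: "x \<in> slab s w T" "x \<in> slab t w U"
    define a b where "a = (s \<bullet> x) / (s \<bullet> w)" and "b = (t \<bullet> x) / (t \<bullet> w)"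
    have "x - a *\<^sub>R w \<in> N" "x - b *\<^sub>R w \<in> N"
      using x mem_facet_iff T by (auto simp: slab_def a_def b_def)
    \<comment> \<open>Each foot point satisfies the constraint of the other facet, which orders the
      two shifts both ways.\<close>
    then have "t \<bullet> (x - a *\<^sub>R w) \<ge> 0" "s \<bullet> (x - b *\<^sub>R w) \<ge> 0"
      using inward_normal_nonneg T by (auto simp: s_def t_def)
    then have "a \<le> b" "b \<le> a"
      using p by (simp_all add: inner_diff_right a_def b_def pos_le_divide_eq)
    then have "a = b" by simp
    then show "q \<bullet> x = 0"
      using p by (simp add: q_def a_def b_def inner_diff_left field_simps)
  qed
  have h: "{x. q \<bullet> x = 0} \<in> sets borel" by (intro borel_closed closed_hyperplane)
  have "{x. q \<bullet> x = 0} \<in> null_sets lborel"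
    using negligible_hyperplane[of q 0] \<open>q \<noteq> 0\<close> h
    by (simp add: negligible_iff_null_sets null_sets_completion_iff)
  then have "{x. q \<bullet> x = 0} \<in> null_sets std_gaussian"
    unfolding std_gaussian_def by (subst null_sets_density_iff) (auto dest: AE_not_in)
  moreover have "slab s w T \<inter> slab t w U \<in> sets std_gaussian"
    using T by (simp add: slab_measurable facet_borel sets.Int)
  ultimately show ?thesis using sub null_sets_subset unfolding s_def t_def by blast
qed

lemma margin_functional_eq:
  "margin_functional N w = (\<Sum>T\<in>{T\<in>facets N. inward_normal N T \<bullet> w > 0}.
     inward_normal N T \<bullet> w / sqrt (2 * pi) * gauss_rel T)"
proof -
  have "margin_functional N w =
      (\<Sum>T\<in>facets N. max 0 (inward_normal N T \<bullet> w) / sqrt (2 * pi) * gauss_rel T)"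
    by (simp add: margin_functional_def sum_distrib_left mult_ac)
  also have "\<dots> = (\<Sum>T\<in>{T\<in>facets N. inward_normal N T \<bullet> w > 0}.
      max 0 (inward_normal N T \<bullet> w) / sqrt (2 * pi) * gauss_rel T)"
    by (rule sum.mono_neutral_right) (use finite_facets in auto)
  finally show ?thesis by (simp add: max_def)
qed

lemma margin_singleton_borel: "margin N {w} \<in> sets borel"
proof -
  have [measurable]: "N \<in> sets borel" by (rule N_borel)
  have "margin N {w} = {x. x \<in> N \<and> x - w \<notin> N}" by (auto simp: margin_singleton)
  then show ?thesis by simp
qed

text \<open>Subadditivity over the covering slabs.\<close>

lemma measure_margin_le:
  "measure std_gaussian (margin N {w}) \<le>
    margin_functional N w * exp (sqrt (real DIM('a) - 1) * norm w)"
proof -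
  define F where "F = {T\<in>facets N. inward_normal N T \<bullet> w > 0}"
  have F: "finite F" using finite_facets by (simp add: F_def)
  have b: "slab (inward_normal N T) w T \<in> sets borel" if "T \<in> F" for T
    using that facet_borel slab_measurable by (auto simp: F_def)
  have "measure std_gaussian (margin N {w}) \<le> measure std_gaussian (\<Union>T\<in>F. slab (inward_normal N T) w T)"
    using margin_subset_slabs b F
    by (intro std_gaussian.finite_measure_mono) (auto simp: F_def)
  also have "\<dots> \<le> (\<Sum>T\<in>F. measure std_gaussian (slab (inward_normal N T) w T))"
    using F b by (intro std_gaussian.finite_measure_subadditive_finite) auto
  also have "\<dots> \<le> (\<Sum>T\<in>F. inward_normal N T \<bullet> w / sqrt (2 * pi) * gauss_rel T *
      exp (sqrt (real DIM('a) - 1) * norm w))"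
  proof (intro sum_mono)
    fix T assume "T \<in> F"
    then have T: "T \<in> facets N" "inward_normal N T \<bullet> w > 0" by (auto simp: F_def)
    show "measure std_gaussian (slab (inward_normal N T) w T) \<le>
        inward_normal N T \<bullet> w / sqrt (2 * pi) * gauss_rel T * exp (sqrt (real DIM('a) - 1) * norm w)"
      unfolding gauss_rel_facet[OF T(1)]
      by (intro measure_slab_le facet_borel norm_inward_normal facet_scaleR_mem_iff T)
  qed
  finally show ?thesis
    by (simp add: margin_functional_eq sum_distrib_right F_def)
qed

text \<open>The slabs lie in the margin and overlap in null sets only, so their measures add
  up.\<close>

lemma measure_margin_ge:
  assumes "w \<in> N"
  shows "measure std_gaussian (margin N {w}) \<ge>
    margin_functional N w * exp (- sqrt (real DIM('a) - 1) * norm w - (norm w)\<^sup>2 / 2)"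
proof -
  define F where "F = {T\<in>facets N. inward_normal N T \<bullet> w > 0}"
  have F: "finite F" using finite_facets by (simp add: F_def)
  have b: "slab (inward_normal N T) w T \<in> sets borel" if "T \<in> F" for T
    using that facet_borel slab_measurable by (auto simp: F_def)
  have "margin_functional N w * exp (- sqrt (real DIM('a) - 1) * norm w - (norm w)\<^sup>2 / 2) =
      (\<Sum>T\<in>F. inward_normal N T \<bullet> w / sqrt (2 * pi) * gauss_rel T *
        exp (- sqrt (real DIM('a) - 1) * norm w - (norm w)\<^sup>2 / 2))"
    by (simp add: margin_functional_eq sum_distrib_right F_def)
  also have "\<dots> \<le> (\<Sum>T\<in>F. measure std_gaussian (slab (inward_normal N T) w T))"
  proof (intro sum_mono)
    fix T assume "T \<in> F"
    then have T: "T \<in> facets N" "inward_normal N T \<bullet> w > 0" by (auto simp: F_def)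
    show "inward_normal N T \<bullet> w / sqrt (2 * pi) * gauss_rel T *
        exp (- sqrt (real DIM('a) - 1) * norm w - (norm w)\<^sup>2 / 2)
        \<le> measure std_gaussian (slab (inward_normal N T) w T)"
      unfolding gauss_rel_facet[OF T(1)]
      by (intro measure_slab_ge facet_borel norm_inward_normal facet_scaleR_mem_iff T)
  qed
  also have "\<dots> = measure std_gaussian (\<Union>T\<in>F. slab (inward_normal N T) w T)"
  proof (intro measure_UNION_AE[symmetric] F)
    show "slab (inward_normal N T) w T \<in> fmeasurable std_gaussian" if "T \<in> F" for T
      using b[OF that] by (simp add: std_gaussian.fmeasurable_eq_sets)
    show "pairwise (\<lambda>T U. AE x in std_gaussian. x \<notin> slab (inward_normal N T) w T \<or>
        x \<notin> slab (inward_normal N U) w U) F"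
    proof (rule pairwiseI)
      fix T U assume "T \<in> F" "U \<in> F" "T \<noteq> U"
      then have "slab (inward_normal N T) w T \<inter> slab (inward_normal N U) w U \<in> null_sets std_gaussian"
        by (intro slab_Int_null) (auto simp: F_def)
      then show "AE x in std_gaussian. x \<notin> slab (inward_normal N T) w T \<or>
          x \<notin> slab (inward_normal N U) w U"
        by (auto dest: AE_not_in)
    qed
  qed
  also have "\<dots> \<le> measure std_gaussian (margin N {w})"
    using slab_subset_margin[OF assms] margin_singleton_borel
    by (intro std_gaussian.finite_measure_mono) (auto simp: F_def)
  finally show ?thesis .
qed

end

section \<open>Normal cones at vertices\<close>

text \<open>The normal cone is local: any \<open>y\<close> in \<open>Q\<close> may be replaced by a
  point of the segment from \<open>z\<close> to \<open>y\<close> close to \<open>z\<close>, which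
  scales \<open>v \<bullet> (y - z)\<close> by some \<open>t > 0\<close>.\<close>

lemma normal_cone_Int_cbox:
  fixes z :: "'a::euclidean_space"
  assumes "convex Q" "z \<in> Q" "z \<in> box a b"
  shows "normal_cone (Q \<inter> cbox a b) z = normal_cone Q z"
proof
  show "normal_cone (Q \<inter> cbox a b) z \<subseteq> normal_cone Q z"
  proof
    fix v assume v: "v \<in> normal_cone (Q \<inter> cbox a b) z"
    show "v \<in> normal_cone Q z"
      unfolding normal_cone_def
    proof safe
      fix y assume y: "y \<in> Q"
      have "((\<lambda>t. z + t *\<^sub>R (y - z)) \<longlongrightarrow> z + 0 *\<^sub>R (y - z)) (at_right 0)"
        by (intro tendsto_intros)
      then have "\<forall>\<^sub>F t in at_right 0. z + t *\<^sub>R (y - z) \<in> box a b"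
        using assms(3) by (intro topological_tendstoD) (auto simp: open_box)
      moreover have "\<forall>\<^sub>F t in at_right (0::real). t < 1"
        by (rule eventually_at_right_real[of 0 1, THEN eventually_mono]) auto
      moreover have "\<forall>\<^sub>F t in at_right (0::real). t > 0" by (rule eventually_at_right_less)
      ultimately have "\<forall>\<^sub>F t in at_right 0. z + t *\<^sub>R (y - z) \<in> box a b \<and> t < 1 \<and> t > 0"
        by eventually_elim simp
      then obtain t where t: "z + t *\<^sub>R (y - z) \<in> box a b" "t < 1" "t > 0"
        using eventually_happens trivial_limit_at_right_real by blast
      have "z + t *\<^sub>R (y - z) = (1 - t) *\<^sub>R z + t *\<^sub>R y" by (simp add: algebra_simps)
      then have "z + t *\<^sub>R (y - z) \<in> Q" using convexD[OF assms(1) assms(2) y, of "1 - t" t] t by simp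
      then have "v \<bullet> (t *\<^sub>R (y - z)) \<le> 0"
        using v t(1) box_subset_cbox by (force simp: normal_cone_def)
      then show "v \<bullet> (y - z) \<le> 0" using t by (simp add: mult_le_0_iff)
    qed
  qed
qed (auto simp: normal_cone_def)

lemma normal_cone_convex_hull:
  "normal_cone (convex hull V) z = {u. \<forall>v\<in>V. u \<bullet> (v - z) \<le> 0}"
proof
  show "{u. \<forall>v\<in>V. u \<bullet> (v - z) \<le> 0} \<subseteq> normal_cone (convex hull V) z"
  proof
    fix u assume "u \<in> {u. \<forall>v\<in>V. u \<bullet> (v - z) \<le> 0}"
    then have "V \<subseteq> {y. u \<bullet> y \<le> u \<bullet> z}" by (auto simp: inner_diff_right)
    then have "convex hull V \<subseteq> {y. u \<bullet> y \<le> u \<bullet> z}" by (rule hull_minimal) (rule convex_halfspace_le)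
    then show "u \<in> normal_cone (convex hull V) z" by (auto simp: normal_cone_def inner_diff_right)
  qed
qed (auto simp: normal_cone_def hull_inc)

text \<open>Cutting the polyhedron down to a box around the vertex leaves a polytope, whose finitely
  many vertices define the normal cone; an exposing functional of \<open>z\<close> is an interior point.\<close>
lemma solid_polyhedral_normal_cone:
  fixes Q :: "'a::euclidean_space set"
  assumes Q: "polyhedron Q" and z: "z extreme_point_of Q"
  shows "solid_polyhedral_cone (normal_cone Q z)"
proof -
  obtain a b where ab: "z \<in> box a b"
    using bounded_subset_box_symmetric[of "{z}"] by (metis bounded_insert bounded_empty insert_subset)
  have zQ: "z \<in> Q" using z by (simp add: extreme_point_of_def)
  have "polytope (Q \<inter> cbox a b)"
    using Q by (simp add: polytope_eq_bounded_polyhedron polyhedron_Int bounded_Int)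
  then obtain V where V: "finite V" and hull: "Q \<inter> cbox a b = convex hull V"
    by (auto simp: polytope_def)
  have N: "normal_cone Q z = {u. \<forall>v\<in>V. u \<bullet> (v - z) \<le> 0}"
    using normal_cone_Int_cbox[OF polyhedron_imp_convex[OF Q] zQ ab] hull
    by (simp add: normal_cone_convex_hull)
  have "normal_cone Q z = \<Inter> ((\<lambda>v. {u. (v - z) \<bullet> u \<le> 0}) ` V)"
    unfolding N by (auto simp: inner_commute)
  also have "polyhedron \<dots>"
    using V by (intro polyhedron_Inter) (auto intro: polyhedron_halfspace_le)
  finally have poly: "polyhedron (normal_cone Q z)" .
  have "z extreme_point_of (convex hull V)"
    using z ab box_subset_cbox[of a b] unfolding hull[symmetric] extreme_point_of_def by blast
  \<comment> \<open>Faces of a polytope are exposed, so some \<open>d\<close> is maximised over the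
    hull at \<open>z\<close> only.\<close>
  then have "{z} exposed_face_of (convex hull V)"
    using V by (simp add: exposed_face_of_polyhedron polyhedron_convex_hull face_of_singleton)
  then obtain d c where dc: "convex hull V \<subseteq> {x. d \<bullet> x \<le> c}" "{z} = convex hull V \<inter> {x. d \<bullet> x = c}"
    unfolding exposed_face_of_def by blast
  have "d \<bullet> v < d \<bullet> z" if "v \<in> V" "v \<noteq> z" for v
  proof -
    have "v \<in> convex hull V" using that by (simp add: hull_inc)
    then have "d \<bullet> v \<le> c" "d \<bullet> v \<noteq> c" using dc that by auto
    moreover have "d \<bullet> z = c" using dc(2) by blast
    ultimately show ?thesis by simp
  qed
  then have "d \<in> (\<Inter>v\<in>V - {z}. {u. (v - z) \<bullet> u < 0})"
    by (auto simp: inner_diff_left inner_commute[of _ d])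
  \<comment> \<open>Finitely many strict inequalities cut out an open set around \<open>d\<close>;
    \<open>v = z\<close> imposes no condition.\<close>
  moreover have "open (\<Inter>v\<in>V - {z}. {u. (v - z) \<bullet> u < 0})"
    using V by (intro open_INT) (auto simp: open_halfspace_lt)
  moreover have "(\<Inter>v\<in>V - {z}. {u. (v - z) \<bullet> u < 0}) \<subseteq> normal_cone Q z"
    unfolding N by (force simp: inner_commute)
  ultimately have "d \<in> interior (normal_cone Q z)" by (meson interiorI)
  moreover have "cone (normal_cone Q z)"
    unfolding N cone_def by (simp add: mult_nonneg_nonpos)
  ultimately show ?thesis using poly by unfold_locales auto
qed

lemma polyhedron_matrix_le:
  fixes A :: "real^'n^'m"
  shows "polyhedron {x. A *v x \<le> b}"
proof -
  have "{x. A *v x \<le> b} = \<Inter> (range (\<lambda>i. {x. A $ i \<bullet> x \<le> b $ i}))"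
    by (auto simp: less_eq_vec_def matrix_vector_mul_component)
  moreover have "polyhedron \<dots>"
    by (intro polyhedron_Inter) (auto intro: polyhedron_halfspace_le)
  ultimately show ?thesis by simp
qed

lemma subdifferential_imp_finite:
  assumes "proper_fun \<psi>" "v \<in> subdifferential \<psi> z"
  shows "\<bar>\<psi> z\<bar> \<noteq> \<infinity>"
proof -
  obtain y where y: "\<psi> y < \<infinity>" using assms(1) by (auto simp: proper_fun_def effective_domain_def)
  have "\<psi> y \<ge> \<psi> z + ereal (v \<bullet> (y - z))" using assms(2) by (simp add: subdifferential_def)
  then have "\<psi> z \<noteq> \<infinity>" using y by auto
  moreover have "\<psi> z \<noteq> -\<infinity>" using assms(1) by (simp add: proper_fun_def)
  ultimately show ?thesis by (cases "\<psi> z") auto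
qed

text \<open>For \<open>\<epsilon> = 0\<close>, 0 is a subgradient of the indicator at a point of the
  domain. Otherwise the inequality is multiplied by \<open>\<epsilon>\<close>; finiteness of
  \<open>\<psi> z\<close> allows distributing in \<open>ereal\<close>.\<close>

lemma scaleR_mem_subdifferential_scale_fun:
  assumes "proper_fun \<psi>" "v \<in> subdifferential \<psi> z" "\<epsilon> \<ge> 0"
  shows "\<epsilon> *\<^sub>R v \<in> subdifferential (scale_fun \<epsilon> \<psi>) z"
proof (cases "\<epsilon> = 0")
  case True
  have "\<psi> z < \<infinity>" using subdifferential_imp_finite[OF assms(1,2)] by auto
  then show ?thesis
    using True by (simp add: subdifferential_def scale_fun_def convex_indicator_def effective_domain_def)
next
  case False
  have "ereal \<epsilon> * \<psi> y \<ge> ereal \<epsilon> * \<psi> z + ereal ((\<epsilon> *\<^sub>R v) \<bullet> (y - z))" for y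
  proof -
    have "ereal \<epsilon> * (\<psi> z + ereal (v \<bullet> (y - z))) \<le> ereal \<epsilon> * \<psi> y"
      using assms by (intro ereal_mult_left_mono) (auto simp: subdifferential_def)
    then show ?thesis
      using subdifferential_imp_finite[OF assms(1,2)] by (cases "\<psi> z") (auto simp: distrib_left)
  qed
  then show ?thesis using False by (simp add: subdifferential_def scale_fun_def)
qed

lemma margin_functional_scaleR:
  "\<epsilon> \<ge> 0 \<Longrightarrow> margin_functional K (\<epsilon> *\<^sub>R w) = \<epsilon> * margin_functional K w"
  by (auto simp: margin_functional_def sum_distrib_left max_def mult_le_0_iff zero_le_mult_iff
      intro!: sum.cong)

section \<open>Margins of sets and positive parts of facet coordinates\<close>

context solid_polyhedral_cone
begin

lemma margin_functional_nonneg: "margin_functional N w \<ge> 0"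
  by (auto simp: margin_functional_def gauss_rel_def intro!: divide_nonneg_nonneg sum_nonneg)

text \<open>The margin shrinks as \<open>W\<close> grows, so one element \<open>w\<close> suffices
  for an upper bound. Monotonicity asks measurability of the larger margin only.\<close>

lemma measure_margin_le_of_mem:
  assumes "w \<in> W"
  shows "measure std_gaussian (margin N W) \<le>
    margin_functional N w * exp (sqrt (real DIM('a) - 1) * norm w)"
proof -
  have "margin N W \<subseteq> margin N {w}"
    using assms unfolding margin_def by (intro Diff_mono set_plus_mono2) auto
  then have "measure std_gaussian (margin N W) \<le> measure std_gaussian (margin N {w})"
    by (rule std_gaussian.finite_measure_mono) (simp add: margin_singleton_borel)
  also note measure_margin_le
  finally show ?thesis .
qed

text \<open>At a simplicial cone, \<open>v\<close> below is the vector obtained from \<open>w\<close> by replacing its facet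
  coordinates with their positive parts.\<close>
lemma
  assumes "\<And>T. T \<in> facets N \<Longrightarrow> inward_normal N T \<bullet> v = max 0 (inward_normal N T \<bullet> w)"
  shows margin_pos_part: "margin N {v} = margin N {w}"
    and margin_functional_pos_part: "margin_functional N v = margin_functional N w"
    and pos_part_mem: "v \<in> N"
proof -
  \<comment> \<open>Facet by facet: where \<open>w\<close> has a negative coordinate, both
    constraints hold since \<open>x\<close> is in \<open>N\<close>; elsewhere \<open>v\<close> and
    \<open>w\<close> agree.\<close>
  have "x - v \<in> N \<longleftrightarrow> x - w \<in> N" if "x \<in> N" for x
    unfolding mem_iff
    by (intro ball_cong refl) (use inward_normal_nonneg that in \<open>auto simp: assms inner_diff_right\<close>)
  then show "margin N {v} = margin N {w}" by (auto simp: margin_singleton)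
  show "margin_functional N v = margin_functional N w"
    by (simp add: margin_functional_def assms)
  show "v \<in> N" by (simp add: mem_iff assms)
qed

end

section \<open>Nondegenerate vertices and the three bounds\<close>

lemma facet_normal_matrix_invertible:
  fixes S :: "real^'n^'n"
  assumes nd: "nondegenerate_vertex A b z" and S: "facet_normal_matrix (normal_cone {x. A *v x \<le> b} z) S"
  shows "invertible S"
proof -
  let ?N = "normal_cone {x. A *v x \<le> b} z"
  interpret solid_polyhedral_cone ?N
    using nd by (intro solid_polyhedral_normal_cone polyhedron_matrix_le)
      (simp add: nondegenerate_vertex_def)
  obtain T where T: "bij_betw T UNIV (facets ?N)" "S = (\<chi> i. inward_normal ?N (T i))"
    using S by (auto simp: facet_normal_matrix_def)
  obtain d a :: "'n \<Rightarrow> real^'n" where N: "?N = {v. \<forall>j. 0 \<le> v \<bullet> d j}"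
    and ad: "\<And>i j. a i \<bullet> d j = (if i = j then 1 else 0)"
    by (rule normal_cone_nondegenerate[OF nd]) (rule that)
  \<comment> \<open>A kernel vector is orthogonal to all facet normals, so it lies in
    \<open>N\<close> with its negative; the dual basis shows that \<open>N\<close> contains no
    line.\<close>
  have "x = 0" if "S *v x = 0" for x
  proof -
    have "inward_normal ?N U \<bullet> x = 0" if U: "U \<in> facets ?N" for U
    proof -
      obtain i where "U = T i" using T(1) U by (auto simp: bij_betw_def)
      then show ?thesis
        using \<open>S *v x = 0\<close> T(2) by (simp add: vec_eq_iff matrix_vector_mul_component)
    qed
    then have "x \<in> ?N" "- x \<in> ?N" unfolding mem_iff by simp_all
    then have xd: "x \<bullet> d j = 0" for j unfolding N by (simp add: order_antisym)
    \<comment> \<open>The rows of \<open>B\<close> and \<open>D\<close> are dual bases, so only 0 is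
      orthogonal to every \<open>d j\<close>.\<close>
    define B D where "B = (\<chi> i. a i)" and "D = (\<chi> j. d j)"
    have "B ** transpose D = mat 1"
      by (simp add: vec_eq_iff matrix_matrix_mult_def transpose_def B_def D_def mat_def
          ad[unfolded inner_vec_def, simplified])
    then have "transpose D ** B = mat 1" by (simp add: matrix_left_right_inverse)
    then have "transpose B ** D = mat 1"
      by (metis matrix_transpose_mul transpose_mat transpose_transpose)
    moreover have "D *v x = 0"
      using xd by (simp add: vec_eq_iff matrix_vector_mul_component D_def inner_commute)
    ultimately show "x = 0" by (metis matrix_left_invertible_ker)
  qed
  then show ?thesis by (metis invertible_left_inverse matrix_left_invertible_ker)
qed

theorem theorem3p3:
  fixes A :: "real^'n^'m" and b :: "real^'m" and Q N :: "(real^'n) set"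
    and \<psi> :: "real^'n \<Rightarrow> ereal" and \<epsilon> :: real and z :: "real^'n"
  assumes Q: "Q = {x. A *v x \<le> b}" and "Q \<noteq> {}"
    and "proper_fun \<psi>" and "convex_fun \<psi>"
    and "\<epsilon> \<ge> 0"
    and "z extreme_point_of Q"
    and N: "N = normal_cone Q z"
  shows
    "(\<forall>v \<in> subdifferential \<psi> z.
        measure std_gaussian (margin N (subdifferential (scale_fun \<epsilon> \<psi>) z))
          \<le> 2 * \<epsilon> * margin_functional N v * exp (\<epsilon> * sqrt (real CARD('n) - 1) * norm v))
     \<and> (\<forall>g. has_gradient \<psi> g z \<and> g \<in> N \<longrightarrow>
        measure std_gaussian (margin N {\<epsilon> *\<^sub>R g})
          \<ge> \<epsilon> * margin_functional N g *
              exp (- \<epsilon> * sqrt (real CARD('n) - 1) * norm g - 1 / 2 * \<epsilon>\<^sup>2 * (norm g)\<^sup>2))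
     \<and> (\<forall>g S vt. has_gradient \<psi> g z \<and> nondegenerate_vertex A b z \<and> facet_normal_matrix N S
          \<and> vt = matrix_inv S *v pos_part (S *v g) \<longrightarrow>
        measure std_gaussian (margin N {\<epsilon> *\<^sub>R g})
          \<ge> \<epsilon> * margin_functional N g *
              exp (- \<epsilon> * sqrt (real CARD('n) - 1) * norm vt - 1 / 2 * \<epsilon>\<^sup>2 * (norm vt)\<^sup>2))"
proof -
  interpret solid_polyhedral_cone N
    unfolding N using assms by (intro solid_polyhedral_normal_cone) (simp_all add: polyhedron_matrix_le)
  \<comment> \<open>Serves twice: for the gradient itself and for \<open>vt\<close>.\<close>
  have lower: "measure std_gaussian (margin N {\<epsilon> *\<^sub>R g}) \<ge> \<epsilon> * margin_functional N g *
      exp (- \<epsilon> * sqrt (real CARD('n) - 1) * norm g - 1 / 2 * \<epsilon>\<^sup>2 * (norm g)\<^sup>2)"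
    if "g \<in> N" for g
  proof -
    have "\<epsilon> *\<^sub>R g \<in> N" using that cone \<open>\<epsilon> \<ge> 0\<close> by (simp add: cone_def)
    from measure_margin_ge[OF this] show ?thesis
      using \<open>\<epsilon> \<ge> 0\<close> by (simp add: margin_functional_scaleR power_mult_distrib mult_ac)
  qed
  show ?thesis
  proof (intro conjI ballI allI impI; (elim conjE)?)
    fix v assume "v \<in> subdifferential \<psi> z"
    then have "measure std_gaussian (margin N (subdifferential (scale_fun \<epsilon> \<psi>) z)) \<le>
        \<epsilon> * margin_functional N v * exp (\<epsilon> * sqrt (real CARD('n) - 1) * norm v)"
      using measure_margin_le_of_mem[OF scaleR_mem_subdifferential_scale_fun] assms
      by (simp add: margin_functional_scaleR mult_ac)
    \<comment> \<open>The bound just obtained is half the claimed one; being nonnegative, it may be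
      doubled.\<close>
    moreover have "0 \<le> \<epsilon> * margin_functional N v * exp (\<epsilon> * sqrt (real CARD('n) - 1) * norm v)"
      using \<open>\<epsilon> \<ge> 0\<close> margin_functional_nonneg by simp
    ultimately show "measure std_gaussian (margin N (subdifferential (scale_fun \<epsilon> \<psi>) z)) \<le>
        2 * \<epsilon> * margin_functional N v * exp (\<epsilon> * sqrt (real CARD('n) - 1) * norm v)"
      by linarith
  next
    fix g assume "g \<in> N"
    then show "\<epsilon> * margin_functional N g *
        exp (- \<epsilon> * sqrt (real CARD('n) - 1) * norm g - 1 / 2 * \<epsilon>\<^sup>2 * (norm g)\<^sup>2)
        \<le> measure std_gaussian (margin N {\<epsilon> *\<^sub>R g})"
      by (rule lower)
  next
    fix g S vt
    assume nd: "nondegenerate_vertex A b z" and S: "facet_normal_matrix N S"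
      and vt: "vt = matrix_inv S *v pos_part (S *v g)"
    have "invertible S" using facet_normal_matrix_invertible nd S by (simp add: N Q)
    then have "S ** matrix_inv S = mat 1"
      unfolding matrix_inv_def invertible_def by (rule someI2_ex) blast
    then have Svt: "S *v vt = pos_part (S *v g)"
      by (simp add: vt matrix_vector_mul_assoc)
    obtain T where T: "bij_betw T UNIV (facets N)" "S = (\<chi> i. inward_normal N (T i))"
      using S by (auto simp: facet_normal_matrix_def)
    \<comment> \<open>Reading \<open>S *v vt\<close> row by row, \<open>vt\<close> has the positive
      parts of the facet coordinates of \<open>g\<close>.\<close>
    have nvt: "inward_normal N U \<bullet> vt = max 0 (inward_normal N U \<bullet> g)" if U: "U \<in> facets N" for U
    proof -
      obtain i where i: "U = T i" using T(1) U by (auto simp: bij_betw_def)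
      have row: "(S *v x) $ i = inward_normal N U \<bullet> x" for x
        by (simp add: T(2) i matrix_vector_mul_component)
      show ?thesis using arg_cong[OF Svt, of "\<lambda>x. x $ i"] by (simp add: row pos_part_def)
    qed
    then have "inward_normal N U \<bullet> (\<epsilon> *\<^sub>R vt) = max 0 (inward_normal N U \<bullet> (\<epsilon> *\<^sub>R g))"
      if "U \<in> facets N" for U
      using that \<open>\<epsilon> \<ge> 0\<close> by (auto simp: max_def mult_le_0_iff zero_le_mult_iff)
    \<comment> \<open>Both the margin and the functional are unchanged by passing from
      \<open>g\<close> to \<open>vt\<close>, and \<open>vt\<close> lies in \<open>N\<close>, so
      \<open>lower\<close> applies to it.\<close>
    then have "margin N {\<epsilon> *\<^sub>R vt} = margin N {\<epsilon> *\<^sub>R g}" by (rule margin_pos_part)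
    then show "\<epsilon> * margin_functional N g *
        exp (- \<epsilon> * sqrt (real CARD('n) - 1) * norm vt - 1 / 2 * \<epsilon>\<^sup>2 * (norm vt)\<^sup>2)
        \<le> measure std_gaussian (margin N {\<epsilon> *\<^sub>R g})"
      using lower[OF pos_part_mem[OF nvt]] margin_functional_pos_part[OF nvt] by simp
  qed
qed

end
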